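(* For each prime $p$, there exist $p$-origamis with isomorphic deck transformation groups that lie in different strata.
   Context: An origami is a connected closed surface obtained from finitely many copies of the Euclidean unit square by gluing edges via translations, so that each left edge is glued to exactly one right edge and each upper edge to exactly one lower edge. It comes with a covering $c:\mathcal{O}\to\mathbb{T}$ of the torus ramified over at most one point (the image of the corners). The deck transformation group consists of all homeomorphisms $f:\mathcal{O}\to\mathcal{O}$ with $c\circ f=c$. The origami is normal if the deck group acts transitively on the squares. Given a finite group $G$ generated by two elements $x,y$, the normal origami $(G,x,y)$ has squares labeled by the elements of $G$, the right neighbor of the square $g$ being $gx$ and its upper neighbor being $gy$; its deck group is $G$, and every normal origami is of this form. A $p$-origami is a normal origami whose deck group is a finite $p$-group. The cone angle at a point of an origami is $2\pi a$ with $a$ a positive integer; $a$ is the multiplicity of the point. A singularity is a point of multiplicity $>1$. For positive integers $a_i,k_i$, the stratum $\mathcal{H}(k_1\times a_1,\dots,k_m\times a_m)$ is the set of translation surfaces with exactly $k_i$ singularities of multiplicity $a_i+1$ for $1\le i\le m$; $\mathcal{H}(0)$ is the set of translation surfaces without singularities. *)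

theory Defs
  imports "HOL-Analysis.Analysis" "HOL-Algebra.Bij" "HOL-Algebra.Coset" "HOL-Library.Multiset"
begin

section \<open>The surface glued from unit squares\<close>

text \<open>The right edge of the square \<open>s\<close> is glued to the left edge of \<open>right_of X s\<close>, and its
  upper edge to the lower edge of \<open>up_of X s\<close>.\<close>

record 'a origami =
  squares :: "'a set"
  right_of :: "'a \<Rightarrow> 'a"
  up_of :: "'a \<Rightarrow> 'a"

abbreviation unit_square :: "(real \<times> real) set" where
  "unit_square \<equiv> {0..1} \<times> {0..1}"

definition disjoint_squares :: "'a origami \<Rightarrow> ('a \<times> (real \<times> real)) topology" where
  "disjoint_squares X =
     prod_topology (discrete_topology (squares X)) (top_of_set unit_square)"

definition glue :: "'a origami \<Rightarrow> ('a \<times> (real \<times> real)) rel" where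
  "glue X =
     {((s, (1, t)), (right_of X s, (0, t))) | s t. s \<in> squares X \<and> t \<in> {0..1}} \<union>
     {((s, (t, 1)), (up_of X s, (t, 0))) | s t. s \<in> squares X \<and> t \<in> {0..1}}"

definition glue_equiv :: "'a origami \<Rightarrow> ('a \<times> (real \<times> real)) rel" where
  "glue_equiv X = (glue X \<union> (glue X)\<inverse>)\<^sup>*"

text \<open>A point of the surface is a whole gluing class of points of the squares.\<close>

definition points :: "'a origami \<Rightarrow> ('a \<times> (real \<times> real)) set set" where
  "points X = topspace (disjoint_squares X) // glue_equiv X"

text \<open>The quotient topology: since the points are disjoint classes, the preimage of a set \<open>U\<close> of
  points under the projection is \<open>\<Union>U\<close>.\<close>

definition surface :: "'a origami \<Rightarrow> ('a \<times> (real \<times> real)) set topology" where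
  "surface X = topology (\<lambda>U. U \<subseteq> points X \<and> openin (disjoint_squares X) (\<Union>U))"

lemma equiv_glue_equiv: "equiv UNIV (glue_equiv X)"
  unfolding glue_equiv_def
  by (intro equivI refl_rtrancl trans_rtrancl sym_rtrancl) (auto simp: sym_def)

lemma points_disjoint:
  assumes "P \<in> points X" "Q \<in> points X" "a \<in> P" "a \<in> Q"
  shows "P = Q"
proof -
  have "P \<in> UNIV // glue_equiv X" "Q \<in> UNIV // glue_equiv X"
    using assms unfolding points_def by (auto simp: quotient_def)
  then show ?thesis using quotient_disj[OF equiv_glue_equiv] assms by blast
qed

lemma openin_surface:
  "openin (surface X) U \<longleftrightarrow> U \<subseteq> points X \<and> openin (disjoint_squares X) (\<Union>U)"
proof -
  have "istopology (\<lambda>U. U \<subseteq> points X \<and> openin (disjoint_squares X) (\<Union>U))"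
    unfolding istopology_def
  proof (intro conjI allI impI; (elim conjE)?)
    fix U V assume h: "U \<subseteq> points X" "openin (disjoint_squares X) (\<Union>U)"
      "V \<subseteq> points X" "openin (disjoint_squares X) (\<Union>V)"
    then have "\<Union>(U \<inter> V) = \<Union>U \<inter> \<Union>V"
      using points_disjoint[of _ X] by blast
    then show "openin (disjoint_squares X) (\<Union>(U \<inter> V))" using h by auto
    show "U \<inter> V \<subseteq> points X" using h by auto
  next
    fix K assume h: "\<forall>U\<in>K. U \<subseteq> points X \<and> openin (disjoint_squares X) (\<Union>U)"
    have "openin (disjoint_squares X) (\<Union>U\<in>K. \<Union>U)" using h by blast
    moreover have "\<Union>(\<Union>K) = (\<Union>U\<in>K. \<Union>U)" by auto
    ultimately show "openin (disjoint_squares X) (\<Union>(\<Union>K))" by simp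
    show "\<Union>K \<subseteq> points X" using h by blast
  qed
  then show ?thesis unfolding surface_def by simp
qed

text \<open>The requirement that edges are glued in pairs makes \<open>surface X\<close> a closed surface; only
  connectedness has to be demanded.\<close>

definition is_origami :: "'a origami \<Rightarrow> bool" where
  "is_origami X \<longleftrightarrow>
     finite (squares X) \<and> squares X \<noteq> {} \<and>
     bij_betw (right_of X) (squares X) (squares X) \<and>
     bij_betw (up_of X) (squares X) (squares X) \<and>
     connected_space (surface X)"


section \<open>Covering of the torus, deck transformations\<close>

text \<open>The torus is the product of two unit circles in the complex plane.\<close>

definition torus_proj :: "real \<times> real \<Rightarrow> complex \<times> complex" where
  "torus_proj z = (cis (2 * pi * fst z), cis (2 * pi * snd z))"

text \<open>On a point of the surface, \<open>torus_proj\<close> takes the same value at all representatives.\<close>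

definition covering :: "'a origami \<Rightarrow> ('a \<times> (real \<times> real)) set \<Rightarrow> complex \<times> complex" where
  "covering X P = the_elem ((\<lambda>(s, z). torus_proj z) ` P)"

text \<open>\<open>Bij\<close> contains only functions that are \<open>undefined\<close> outside the surface, so that every
  homeomorphism is represented by exactly one function.\<close>

definition deck_group ::
    "'a origami \<Rightarrow> (('a \<times> (real \<times> real)) set \<Rightarrow> ('a \<times> (real \<times> real)) set) monoid" where
  "deck_group X = BijGroup (points X)
     \<lparr>carrier := {f \<in> Bij (points X). homeomorphic_map (surface X) (surface X) f \<and>
                    (\<forall>P \<in> points X. covering X (f P) = covering X P)}\<rparr>"

definition closed_square :: "'a origami \<Rightarrow> 'a \<Rightarrow> ('a \<times> (real \<times> real)) set set" where
  "closed_square X s = {P \<in> points X. \<exists>z. (s, z) \<in> P}"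

definition normal_origami :: "'a origami \<Rightarrow> bool" where
  "normal_origami X \<longleftrightarrow> is_origami X \<and>
     (\<forall>s \<in> squares X. \<forall>t \<in> squares X.
        \<exists>f \<in> carrier (deck_group X). f ` closed_square X s = closed_square X t)"

definition p_origami :: "nat \<Rightarrow> 'a origami \<Rightarrow> bool" where
  "p_origami p X \<longleftrightarrow> normal_origami X \<and> finite (carrier (deck_group X)) \<and>
     (\<exists>n. order (deck_group X) = p ^ n)"


section \<open>Cone angles and strata\<close>

text \<open>The interior angle of the unit square at one of its points.\<close>

definition square_angle :: "real \<times> real \<Rightarrow> real" where
  "square_angle z =
     (if fst z \<in> {0, 1} \<and> snd z \<in> {0, 1} then pi / 2
      else if fst z \<in> {0, 1} \<or> snd z \<in> {0, 1} then pi
      else 2 * pi)"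

definition cone_angle :: "('a \<times> (real \<times> real)) set \<Rightarrow> real" where
  "cone_angle P = (\<Sum>(s, z) \<in> P. square_angle z)"

definition has_multiplicity :: "('a \<times> (real \<times> real)) set \<Rightarrow> nat \<Rightarrow> bool" where
  "has_multiplicity P a \<longleftrightarrow> a > 0 \<and> cone_angle P = 2 * pi * real a"

text \<open>The stratum \<open>H(k\<^sub>1 \<times> a\<^sub>1, \<dots>, k\<^sub>m \<times> a\<^sub>m)\<close> is indexed by the multiset containing each \<open>a\<^sub>i\<close>
  exactly \<open>k\<^sub>i\<close> times, and \<open>H(0)\<close> by the empty multiset. Of each stratum only the
  translation surfaces that are origamis are considered.\<close>

definition stratum :: "nat multiset \<Rightarrow> 'a origami set" where
  "stratum \<mu> = {X. is_origami X \<and>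
     (\<forall>a > 0. finite {P \<in> points X. has_multiplicity P (a + 1)} \<and>
               card {P \<in> points X. has_multiplicity P (a + 1)} = count \<mu> a)}"

definition strata :: "'a origami set set" where
  "strata = {stratum \<mu> | \<mu>. \<forall>a \<in># \<mu>. a > 0}"

end

theory Submission
  imports Defs "HOL-Algebra.Elementary_Groups" "HOL-Algebra.Left_Coset"
    "HOL-Algebra.Multiplicative_Group" "HOL-Algebra.Weak_Morphisms" "HOL-Number_Theory.Cong"
begin

text \<open>
  Two generators \<open>x\<close>, \<open>y\<close> of a finite group \<open>G\<close> give a normal origami whose squares are the
  elements of \<open>G\<close>. Its deck group is \<open>G\<close>, acting by left multiplication (\<open>act_iso\<close>). Walking once
  around the corner of a square multiplies its name from the right by a commutator of \<open>x\<close> and \<open>y\<close>,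
  so every corner has multiplicity \<open>ord [x, y]\<close> and all other points are regular; the stratum
  therefore determines \<open>ord [x, y]\<close> (\<open>same_stratum_same_commutator_order\<close>). It remains to find a finite
  \<open>p\<close>-group with two generating pairs whose commutators have different orders
  (\<open>p_group_with_two_commutator_orders\<close>).

  The two pairs are \<open>(x, y)\<close> and \<open>(x\<^sup>k, y)\<close> with \<open>k\<close> prime to \<open>p\<close>; they obviously generate the same
  group. The group is found in a tower of wreath products with the cyclic group of order
  \<open>q = p\<^sup>2\<close>, and \<open>k = q + 1\<close>. In a wreath product, the \<open>q\<close>-th power of a shift decorated with \<open>a\<close>
  in one place is the constant vector \<open>a\<close>. First, this
  produces \<open>\<alpha>\<close>, \<open>\<beta>\<close> with \<open>\<alpha>\<^sup>q = \<beta>\<^sup>q = 1\<close> and \<open>(\<alpha>\<beta>)\<^sup>q \<noteq> 1\<close>. Secondly, shifts \<open>s\<close> and \<open>t\<close> that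
  carry \<open>\<alpha>\<close> and \<open>\<beta>\<inverse>\<close> in different places have \<open>s t\<inverse>\<close> of order dividing \<open>q\<close>, as \<open>\<alpha>\<close> and \<open>\<beta>\<close> do not
  meet, whereas in \<open>s\<^sup>k t\<^sup>-\<^sup>k\<close> they are spread to all places by \<open>s\<^sup>q\<close> and \<open>t\<^sup>q\<close> and meet in \<open>\<alpha>\<beta>\<close>. Thirdly,
  the commutator of the vector \<open>x = (s, t, \<dots>, t)\<close> with the shift \<open>y\<close> is, up to conjugation, a vector with the
  entries \<open>s t\<inverse>\<close>, \<open>t s\<inverse>\<close> and \<open>1\<close>. This turns quotients into commutators, for \<open>x\<^sup>k = (s\<^sup>k, t\<^sup>k, \<dots>, t\<^sup>k)\<close> as
  well.

  That the deck group is no larger than \<open>G\<close> is a rigidity statement: two continuous maps of the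
  surface over the torus that agree at one point other than a corner are equal. They disagree on an open set,
  since distinct points over the same point of the torus have disjoint stars. They agree on an
  open set away from the corners, since there the star of a point is embedded in the torus. A square without
  its corners is connected, and so is the surface; the corners follow by density.
\<close>

section \<open>Wreath products with cyclic groups\<close>

text \<open>Among the usual conventions, this is the one with \<open>x y = y x [x, y]\<close>: going right and then up
  from a square differs from going up and then right by \<open>[x, y]\<close> on the right.\<close>

definition commutator :: "('a, 'b) monoid_scheme \<Rightarrow> 'a \<Rightarrow> 'a \<Rightarrow> 'a" where
  "commutator G x y = inv\<^bsub>G\<^esub> (y \<otimes>\<^bsub>G\<^esub> x) \<otimes>\<^bsub>G\<^esub> (x \<otimes>\<^bsub>G\<^esub> y)"

text \<open>The pair \<open>(f, i)\<close> stands for the vector \<open>f\<close> followed by the shift by \<open>i\<close>; moving a shift past a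
  vector rotates the vector. Vectors are \<open>undefined\<close> from index \<open>m\<close> on, which makes equality of pairs
  equality in the group.\<close>

definition wreath :: "('a, 'b) monoid_scheme \<Rightarrow> nat \<Rightarrow> ((nat \<Rightarrow> 'a) \<times> nat) monoid" where
  "wreath K m = \<lparr>carrier = ({..<m} \<rightarrow>\<^sub>E carrier K) \<times> {..<m},
     mult = \<lambda>(f, i) (g, j). (\<lambda>l\<in>{..<m}. f l \<otimes>\<^bsub>K\<^esub> g ((l + i) mod m), (i + j) mod m),
     one = (\<lambda>l\<in>{..<m}. \<one>\<^bsub>K\<^esub>, 0)\<rparr>"

text \<open>The products \<open>a b\<close> and \<open>b a\<close> are conjugate.\<close>

lemma (in group) pow_mult_swap_eq_one:
  assumes a: "a \<in> carrier G" and b: "b \<in> carrier G" and ab: "(a \<otimes> b) [^] (n::nat) = \<one>"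
  shows "(b \<otimes> a) [^] n = \<one>"
proof -
  have "b \<otimes> (a \<otimes> b) [^] n = (b \<otimes> a) [^] n \<otimes> b" for n :: nat
  proof (induction n)
    case (Suc n)
    have "b \<otimes> (a \<otimes> b) [^] Suc n = (b \<otimes> (a \<otimes> b) [^] n) \<otimes> (a \<otimes> b)"
      using a b by (simp add: m_assoc)
    also have "\<dots> = (b \<otimes> a) [^] Suc n \<otimes> b" using a b by (simp add: Suc.IH m_assoc)
    finally show ?case .
  qed (use b in simp)
  from this[of n] show ?thesis using a b ab by (simp add: r_cancel_one')
qed

lemma restrict_eq_at: "restrict f A = restrict g A \<Longrightarrow> l \<in> A \<Longrightarrow> f l = g l"
  by (metis restrict_apply')

locale wreath_product = K: group K for K (structure) + fixes m :: nat assumes m_pos: "m > 0"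
begin

abbreviation W where "W \<equiv> wreath K m"

lemma carrier_W: "(f, i) \<in> carrier W \<longleftrightarrow> f \<in> {..<m} \<rightarrow>\<^sub>E carrier K \<and> i < m"
  by (simp add: wreath_def)

lemma mult_W: "(f, i) \<otimes>\<^bsub>W\<^esub> (g, j) = (\<lambda>l\<in>{..<m}. f l \<otimes> g ((l + i) mod m), (i + j) mod m)"
  by (simp add: wreath_def)

lemma one_W: "\<one>\<^bsub>W\<^esub> = (\<lambda>l\<in>{..<m}. \<one>, 0)"
  by (simp add: wreath_def)

lemma group_W: "group W"
proof (rule groupI)
  fix a b assume "a \<in> carrier W" "b \<in> carrier W"
  then show "a \<otimes>\<^bsub>W\<^esub> b \<in> carrier W"
    using m_pos by (cases a, cases b) (auto simp: carrier_W mult_W PiE_iff)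
next
  show "\<one>\<^bsub>W\<^esub> \<in> carrier W" using m_pos by (auto simp: one_W carrier_W)
next
  fix a b c assume "a \<in> carrier W" "b \<in> carrier W" "c \<in> carrier W"
  moreover have "(l + (i + j) mod m) mod m = ((l + i) mod m + j) mod m" for l i j
    by (simp add: mod_simps add.assoc)
  ultimately show "a \<otimes>\<^bsub>W\<^esub> b \<otimes>\<^bsub>W\<^esub> c = a \<otimes>\<^bsub>W\<^esub> (b \<otimes>\<^bsub>W\<^esub> c)"
    using m_pos
    by (cases a, cases b, cases c)
       (auto simp: carrier_W mult_W mod_simps add.assoc PiE_iff K.m_assoc intro!: restrict_ext)
next
  fix a assume "a \<in> carrier W"
  then show "\<one>\<^bsub>W\<^esub> \<otimes>\<^bsub>W\<^esub> a = a"
    using m_pos by (cases a) (auto simp: carrier_W mult_W one_W PiE_iff extensional_def)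
next
  fix a assume "a \<in> carrier W"
  then obtain f i where a: "a = (f, i)" "f \<in> {..<m} \<rightarrow>\<^sub>E carrier K" "i < m"
    by (cases a) (auto simp: carrier_W)
  let ?j = "(m - i) mod m"
  let ?g = "\<lambda>l\<in>{..<m}. inv (f ((l + ?j) mod m))"
  have "(?g, ?j) \<in> carrier W" using a m_pos by (auto simp: carrier_W PiE_iff)
  moreover have "(?g, ?j) \<otimes>\<^bsub>W\<^esub> a = \<one>\<^bsub>W\<^esub>"
    using a m_pos by (auto simp: mult_W one_W PiE_iff mod_simps intro!: restrict_ext)
  ultimately show "\<exists>b\<in>carrier W. b \<otimes>\<^bsub>W\<^esub> a = \<one>\<^bsub>W\<^esub>" by blast
qed

sublocale W: group W by (rule group_W)

lemma order_W: "order W = order K ^ m * m"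
  by (simp add: order_def wreath_def card_cartesian_product card_PiE)

definition dirac :: "nat \<Rightarrow> 'a \<Rightarrow> nat \<Rightarrow> 'a" where
  "dirac j a = (\<lambda>l\<in>{..<m}. if l = j then a else \<one>)"

lemma dirac_closed: "a \<in> carrier K \<Longrightarrow> dirac j a \<in> {..<m} \<rightarrow>\<^sub>E carrier K"
  by (auto simp: dirac_def)

lemma mult_inv_same_shift:
  assumes "(f, i) \<in> carrier W" "(g, i) \<in> carrier W"
  shows "(f, i) \<otimes>\<^bsub>W\<^esub> inv\<^bsub>W\<^esub> (g, i) = (\<lambda>l\<in>{..<m}. f l \<otimes> inv (g l), 0)"
proof (rule W.inv_solve_right'[THEN iffD2])
  show "(\<lambda>l\<in>{..<m}. f l \<otimes> inv (g l), 0) \<in> carrier W"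
    using assms m_pos by (auto simp: carrier_W PiE_iff)
  have "f l \<otimes> inv (g l) \<otimes> g l = f l" if "l < m" for l
    using that assms by (auto simp: carrier_W PiE_iff K.m_assoc)
  then show "(f, i) = (\<lambda>l\<in>{..<m}. f l \<otimes> inv (g l), 0) \<otimes>\<^bsub>W\<^esub> (g, i)"
    using assms by (auto simp: carrier_W mult_W PiE_iff extensional_def)
qed (use assms in auto)

lemma base_pow:
  assumes "f \<in> {..<m} \<rightarrow>\<^sub>E carrier K"
  shows "(f, 0) [^]\<^bsub>W\<^esub> (n::nat) = (\<lambda>l\<in>{..<m}. f l [^] n, 0)"
proof (induction n)
  case 0
  then show ?case by (auto simp: one_W)
next
  case (Suc n)
  then show ?case using assms by (auto simp: mult_W PiE_iff intro!: restrict_ext)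
qed

text \<open>During \<open>m\<close> shifts the entry \<open>a\<close> visits every place exactly once. After \<open>n \<le> m\<close> of them, it
  has visited the \<open>n\<close> places that lie cyclically just before or at \<open>j\<close>.\<close>

lemma dirac_shift_pow:
  assumes a: "a \<in> carrier K" and j: "j < m"
  shows "(dirac j a, 1 mod m) [^]\<^bsub>W\<^esub> m = (\<lambda>l\<in>{..<m}. a, 0)"
proof -
  have "(dirac j a, 1 mod m) [^]\<^bsub>W\<^esub> n =
      (\<lambda>l\<in>{..<m}. if l \<le> j \<and> j < l + n \<or> j + m < l + n then a else \<one>, n mod m)" if "n \<le> m" for n
    using that
  proof (induction n)
    case 0
    then show ?case using j by (auto simp: one_W restrict_def fun_eq_iff)
  next
    case (Suc n)
    have e: "(l + n mod m) mod m = (l + n) mod m" for l by (simp add: mod_simps)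
    have "(l + n) mod m = j \<longleftrightarrow> l + n = j \<or> l + n = j + m" if "l < m" for l
    proof (cases "l + n < m")
      case True
      then show ?thesis using j by auto
    next
      case False
      then have "(l + n) mod m = l + n - m" using that Suc.prems by (simp add: le_mod_geq)
      then show ?thesis using j False by auto
    qed
    then show ?case
      using Suc a j m_pos
      by (auto simp: mult_W e dirac_def mod_simps intro!: restrict_ext)
  qed
  from this[of m] j show ?thesis by (auto intro!: restrict_ext)
qed

end

text \<open>Take for \<open>\<alpha>\<close> the shift and for \<open>\<beta>\<close> the element \<open>g\<close> in one place. The power \<open>(\<alpha> \<beta>)\<^sup>m\<close> is then the
  constant vector \<open>g\<close>.\<close>

lemma (in wreath_product) product_has_larger_order:
  assumes "m \<ge> 2" "g \<in> carrier K" "g [^] m = \<one>" "g \<noteq> \<one>"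
  shows "\<exists>\<alpha>\<in>carrier W. \<exists>\<beta>\<in>carrier W. \<alpha> [^]\<^bsub>W\<^esub> m = \<one>\<^bsub>W\<^esub> \<and> \<beta> [^]\<^bsub>W\<^esub> m = \<one>\<^bsub>W\<^esub> \<and>
           (\<alpha> \<otimes>\<^bsub>W\<^esub> \<beta>) [^]\<^bsub>W\<^esub> m \<noteq> \<one>\<^bsub>W\<^esub>"
proof -
  let ?\<alpha> = "(dirac 0 \<one>, 1 mod m)" and ?\<beta> = "(dirac 0 g, 0)"
  have "?\<alpha> \<in> carrier W" "?\<beta> \<in> carrier W"
    using assms m_pos by (auto simp: carrier_W dirac_closed)
  moreover have "?\<alpha> [^]\<^bsub>W\<^esub> m = \<one>\<^bsub>W\<^esub>"
    using dirac_shift_pow[of \<one> 0] m_pos by (simp add: one_W)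
  moreover have "?\<beta> [^]\<^bsub>W\<^esub> m = \<one>\<^bsub>W\<^esub>"
    using assms by (auto simp: base_pow dirac_closed one_W dirac_def intro!: restrict_ext)
  moreover have "(?\<alpha> \<otimes>\<^bsub>W\<^esub> ?\<beta>) [^]\<^bsub>W\<^esub> m \<noteq> \<one>\<^bsub>W\<^esub>"
  proof -
    have "(l + 1) mod m = 0 \<longleftrightarrow> l = m - 1" if "l < m" for l
      using that assms(1) by (cases "l + 1 = m") auto
    then have "?\<alpha> \<otimes>\<^bsub>W\<^esub> ?\<beta> = (dirac (m - 1) g, 1 mod m)"
      using assms by (auto simp: mult_W dirac_def intro!: restrict_ext)
    then have "(?\<alpha> \<otimes>\<^bsub>W\<^esub> ?\<beta>) [^]\<^bsub>W\<^esub> m = (\<lambda>l\<in>{..<m}. g, 0)"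
      using dirac_shift_pow[of g "m - 1"] assms m_pos by simp
    then show ?thesis
      using assms(4) m_pos by (auto simp: one_W dest!: restrict_eq_at[of _ _ _ 0])
  qed
  ultimately show ?thesis by blast
qed

text \<open>Here \<open>s\<close> and \<open>t\<close> are shifts that carry \<open>a\<close> in the last and \<open>b\<inverse>\<close> in the first place. The entries of
  \<open>s t\<inverse>\<close> are \<open>a\<close>, \<open>b\<close> and \<open>1\<close>. Since \<open>s\<^sup>m\<close> and \<open>t\<^sup>m\<close> are the constant vectors \<open>a\<close> and \<open>b\<inverse>\<close>, the exponent
  \<open>m + 1\<close> puts \<open>a b\<close> into every place other than the first and the last; \<open>m \<ge> 3\<close> ensures that there is one.\<close>

lemma (in wreath_product) power_changes_quotient_order:
  assumes m: "m \<ge> 3" and ab: "a \<in> carrier K" "b \<in> carrier K"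
    and "a [^] m = \<one>" "b [^] m = \<one>" "(a \<otimes> b) [^] m \<noteq> \<one>"
  shows "\<exists>s\<in>carrier W. \<exists>t\<in>carrier W. (s \<otimes>\<^bsub>W\<^esub> inv\<^bsub>W\<^esub> t) [^]\<^bsub>W\<^esub> m = \<one>\<^bsub>W\<^esub> \<and>
           (s [^]\<^bsub>W\<^esub> Suc m \<otimes>\<^bsub>W\<^esub> inv\<^bsub>W\<^esub> (t [^]\<^bsub>W\<^esub> Suc m)) [^]\<^bsub>W\<^esub> m \<noteq> \<one>\<^bsub>W\<^esub>"
proof -
  let ?s = "(dirac (m - 1) a, 1 mod m)" and ?t = "(dirac 0 (inv b), 1 mod m)"
  have s: "?s \<in> carrier W" and t: "?t \<in> carrier W"
    using ab m by (auto simp: carrier_W dirac_closed)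
  have st: "?s \<otimes>\<^bsub>W\<^esub> inv\<^bsub>W\<^esub> ?t
      = (\<lambda>l\<in>{..<m}. if l = m - 1 then a else if l = 0 then b else \<one>, 0)"
    using mult_inv_same_shift[OF s t] ab m by (auto simp: dirac_def intro!: restrict_ext)
  have one: "(?s \<otimes>\<^bsub>W\<^esub> inv\<^bsub>W\<^esub> ?t) [^]\<^bsub>W\<^esub> m = \<one>\<^bsub>W\<^esub>"
    using assms unfolding st by (subst base_pow) (auto simp: one_W intro!: restrict_ext)
  have sp: "?s [^]\<^bsub>W\<^esub> Suc m = (\<lambda>l\<in>{..<m}. a \<otimes> dirac (m - 1) a l, 1 mod m)"
    using dirac_shift_pow[of a "m - 1"] ab m
    by (auto simp: mult_W intro!: restrict_ext)
  have tp: "?t [^]\<^bsub>W\<^esub> Suc m = (\<lambda>l\<in>{..<m}. inv b \<otimes> dirac 0 (inv b) l, 1 mod m)"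
    using dirac_shift_pow[of "inv b" 0] ab m
    by (auto simp: mult_W intro!: restrict_ext)
  \<comment> \<open>The entry of interest is the one at index 1.\<close>
  let ?f = "\<lambda>l\<in>{..<m}. (a \<otimes> dirac (m - 1) a l) \<otimes> inv (inv b \<otimes> dirac 0 (inv b) l)"
  have "?s [^]\<^bsub>W\<^esub> Suc m \<otimes>\<^bsub>W\<^esub> inv\<^bsub>W\<^esub> (?t [^]\<^bsub>W\<^esub> Suc m) = (?f, 0)"
    unfolding sp tp using ab m
    by (subst mult_inv_same_shift) (auto simp: carrier_W dirac_def intro!: restrict_ext)
  moreover have "?f \<in> {..<m} \<rightarrow>\<^sub>E carrier K" using ab by (auto simp: dirac_def)
  moreover have "?f 1 = a \<otimes> b" using ab m by (auto simp: dirac_def)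
  ultimately have "(?s [^]\<^bsub>W\<^esub> Suc m \<otimes>\<^bsub>W\<^esub> inv\<^bsub>W\<^esub> (?t [^]\<^bsub>W\<^esub> Suc m)) [^]\<^bsub>W\<^esub> m \<noteq> \<one>\<^bsub>W\<^esub>"
    using assms(6) m by (auto simp: base_pow one_W simp del: W.nat_pow_Suc dest!: restrict_eq_at[of _ _ _ 1])
  with s t one show ?thesis by blast
qed

text \<open>For \<open>x = (s, t, \<dots>, t)\<close> and \<open>y\<close> the shift, \<open>y x\<^sup>k y\<inverse>\<close> is the rotated vector \<open>x\<^sup>k\<close>. It differs from
  \<open>x\<^sup>k\<close> in at most two places, where the quotients are \<open>s\<^sup>k t\<^sup>-\<^sup>k\<close> and its inverse; and the quotient
  \<open>x\<^sup>k (y x\<^sup>k y\<inverse>)\<inverse>\<close> is conjugate to the commutator. One choice of \<open>x\<close> and \<open>y\<close> serves all exponents.\<close>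

lemma (in wreath_product) quotients_to_commutators:
  assumes m: "m \<ge> 2" and st: "s \<in> carrier K" "t \<in> carrier K"
  shows "\<exists>x\<in>carrier W. \<exists>y\<in>carrier W. \<forall>(k :: nat) (n :: nat).
           commutator W (x [^]\<^bsub>W\<^esub> k) y [^]\<^bsub>W\<^esub> n = \<one>\<^bsub>W\<^esub> \<longleftrightarrow> (s [^] k \<otimes> inv (t [^] k)) [^] n = \<one>"
proof -
  let ?x = "(\<lambda>l\<in>{..<m}. if l = 0 then s else t, 0::nat)"
  let ?y = "(\<lambda>l\<in>{..<m}. \<one>, 1 mod m)"
  have xy: "?x \<in> carrier W" "?y \<in> carrier W" using st m by (auto simp: carrier_W)
  moreover have "commutator W (?x [^]\<^bsub>W\<^esub> k) ?y [^]\<^bsub>W\<^esub> n = \<one>\<^bsub>W\<^esub> \<longleftrightarrow> (s [^] k \<otimes> inv (t [^] k)) [^] n = \<one>"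
    for k n :: nat
  proof -
    let ?S = "s [^] k" and ?T = "t [^] k"
    have ST: "?S \<in> carrier K" "?T \<in> carrier K" using st by auto
    have xk: "?x [^]\<^bsub>W\<^esub> k = (\<lambda>l\<in>{..<m}. if l = 0 then ?S else ?T, 0)"
      using st by (subst base_pow) (auto intro!: restrict_ext)
    have 1: "?x [^]\<^bsub>W\<^esub> k \<otimes>\<^bsub>W\<^esub> ?y = (\<lambda>l\<in>{..<m}. if l = 0 then ?S else ?T, 1 mod m)"
      unfolding xk using ST m by (auto simp: mult_W intro!: restrict_ext)
    have "(l + 1) mod m = 0 \<longleftrightarrow> l = m - 1" if "l < m" for l
      using that m by (cases "l + 1 = m") auto
    then have 2: "?y \<otimes>\<^bsub>W\<^esub> ?x [^]\<^bsub>W\<^esub> k = (\<lambda>l\<in>{..<m}. if l = m - 1 then ?S else ?T, 1 mod m)"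
      unfolding xk using ST m by (auto simp: mult_W intro!: restrict_ext)
    let ?f = "\<lambda>l\<in>{..<m}. if l = 0 then ?S \<otimes> inv ?T else if l = m - 1 then ?T \<otimes> inv ?S else \<one>"
    have eq: "(?x [^]\<^bsub>W\<^esub> k \<otimes>\<^bsub>W\<^esub> ?y) \<otimes>\<^bsub>W\<^esub> inv\<^bsub>W\<^esub> (?y \<otimes>\<^bsub>W\<^esub> ?x [^]\<^bsub>W\<^esub> k) = (?f, 0)"
      unfolding 1 2 using ST m
      by (subst mult_inv_same_shift) (auto simp: carrier_W intro!: restrict_ext)
    have f: "?f \<in> {..<m} \<rightarrow>\<^sub>E carrier K" using ST by auto
    have "?T \<otimes> inv ?S = inv (?S \<otimes> inv ?T)" using ST by (simp add: K.inv_mult_group)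
    then have "(?S \<otimes> inv ?T) [^] n = \<one> \<Longrightarrow> (?T \<otimes> inv ?S) [^] n = \<one>"
      using ST by (simp add: K.nat_pow_inv)
    then have "((?x [^]\<^bsub>W\<^esub> k \<otimes>\<^bsub>W\<^esub> ?y) \<otimes>\<^bsub>W\<^esub> inv\<^bsub>W\<^esub> (?y \<otimes>\<^bsub>W\<^esub> ?x [^]\<^bsub>W\<^esub> k)) [^]\<^bsub>W\<^esub> n = \<one>\<^bsub>W\<^esub>
        \<longleftrightarrow> (?S \<otimes> inv ?T) [^] n = \<one>"
      unfolding eq base_pow[OF f] one_W using m ST
      by (auto intro!: restrict_ext dest!: restrict_eq_at[of _ _ _ 0])
    moreover have "?x [^]\<^bsub>W\<^esub> k \<otimes>\<^bsub>W\<^esub> ?y \<in> carrier W" "inv\<^bsub>W\<^esub> (?y \<otimes>\<^bsub>W\<^esub> ?x [^]\<^bsub>W\<^esub> k) \<in> carrier W"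
      using xy by auto
    ultimately show "commutator W (?x [^]\<^bsub>W\<^esub> k) ?y [^]\<^bsub>W\<^esub> n = \<one>\<^bsub>W\<^esub> \<longleftrightarrow> (?S \<otimes> inv ?T) [^] n = \<one>"
      unfolding commutator_def using W.pow_mult_swap_eq_one by blast
  qed
  ultimately show ?thesis by blast
qed

section \<open>A p-group with two commutator orders\<close>

text \<open>Modulo the order of the group \<open>k\<close> is invertible, so \<open>x\<close> is itself a power of \<open>x\<^sup>k\<close>.\<close>

lemma (in group) generate_replace_by_coprime_power:
  assumes xy: "x \<in> carrier G" "y \<in> carrier G" and fin: "finite (carrier G)"
    and k: "coprime k (order G)"
  shows "generate G {x [^] k, y} = generate G {x, y}"
proof
  interpret A: subgroup "generate G {x, y}" G
    using xy by (intro generate_is_subgroup) auto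
  interpret B: subgroup "generate G {x [^] k, y}" G
    using xy by (intro generate_is_subgroup) auto
  have pow_closed: "z [^] n \<in> H" if "subgroup H G" "z \<in> H" for z H and n :: nat
    using that by (induction n) (auto simp: subgroup.one_closed subgroup.m_closed)
  have "x [^] k \<in> generate G {x, y}"
    by (intro pow_closed A.subgroup_axioms generate.incl) auto
  then show "generate G {x [^] k, y} \<subseteq> generate G {x, y}"
    by (intro generate_subgroup_incl A.subgroup_axioms) (auto intro: generate.incl)
  obtain l where l: "[k * l = 1] (mod order G)" using cong_solve_coprime_nat[OF k] by auto
  have red: "x [^] n = x [^] (n mod order G)" for n :: nat
  proof -
    have "x [^] n = x [^] (order G * (n div order G) + n mod order G)" by simp
    also have "\<dots> = x [^] (n mod order G)"
      using xy by (subst nat_pow_mult[symmetric]) (auto simp: nat_pow_pow[symmetric] pow_order_eq_1)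
    finally show ?thesis .
  qed
  have "(x [^] k) [^] l = x"
    using l red[of "k * l"] red[of 1] xy by (simp add: nat_pow_pow cong_def)
  moreover have "(x [^] k) [^] l \<in> generate G {x [^] k, y}"
    by (rule pow_closed[OF B.subgroup_axioms], rule generate.incl) simp
  ultimately have "x \<in> generate G {x [^] k, y}" by simp
  moreover have "y \<in> generate G {x [^] k, y}" by (rule generate.incl) simp
  ultimately have "{x, y} \<subseteq> generate G {x [^] k, y}" by blast
  then show "generate G {x, y} \<subseteq> generate G {x [^] k, y}"
    using B.subgroup_axioms by (rule generate_subgroup_incl)
qed

lemma (in group) exists_iso_nat_group:
  assumes "finite (carrier G)"
  shows "\<exists>N :: nat monoid. \<exists>h. group N \<and> h \<in> iso G N"
proof -
  obtain f :: "'a \<Rightarrow> nat" where "inj_on f (carrier G)"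
    using finite_imp_inj_to_nat_seg[OF assms] by blast
  then show ?thesis
    using inj_imp_image_group_is_group inj_imp_image_group_iso by blast
qed

text \<open>Modulus \<open>p\<^sup>2\<close> instead of \<open>p\<close> leaves room for a third place when \<open>p = 2\<close>. The result is
  transported to a group of natural numbers, as its elements are to serve as the squares of an
  origami of type \<open>nat origami\<close>.\<close>

lemma wreath_tower:
  fixes p :: nat
  assumes p: "prime p"
  shows "\<exists>(N :: nat monoid) x y. \<exists>q n. group N \<and> finite (carrier N) \<and> order N = p ^ n \<and>
    x \<in> carrier N \<and> y \<in> carrier N \<and> p dvd q \<and>
    commutator N x y [^]\<^bsub>N\<^esub> q = \<one>\<^bsub>N\<^esub> \<and> commutator N (x [^]\<^bsub>N\<^esub> Suc q) y [^]\<^bsub>N\<^esub> q \<noteq> \<one>\<^bsub>N\<^esub>"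
proof -
  define q where "q = p\<^sup>2"
  have "p \<ge> 2" using p by (simp add: prime_ge_2_nat)
  then have "p\<^sup>2 \<ge> 2\<^sup>2" by (rule power_mono) simp
  then have q: "q \<ge> 3" by (simp add: q_def)
  let ?K = "integer_mod_group q"
  interpret A: wreath_product ?K q
    using q by (simp add: wreath_product_def wreath_product_axioms_def)
  interpret B: wreath_product A.W q
    using q by (simp add: wreath_product_def wreath_product_axioms_def A.group_W)
  interpret C: wreath_product B.W q
    using q by (simp add: wreath_product_def wreath_product_axioms_def B.group_W)
  have "order ?K = q" using q by (simp add: order_def carrier_integer_mod_group)
  then have "order C.W = ((q ^ q * q) ^ q * q) ^ q * q"
    by (simp only: A.order_W B.order_W C.order_W)
  also have "\<dots> = p ^ (2 * (((q + 1) * q + 1) * q + 1))"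
    by (simp add: q_def algebra_simps flip: power_mult power_add)
  finally obtain n where n: "order C.W = p ^ n" by blast
  have fin: "finite (carrier C.W)"
    using n \<open>p \<ge> 2\<close> by (intro card_ge_0_finite) (simp add: order_def)
  obtain a b where ab: "a \<in> carrier A.W" "b \<in> carrier A.W" "a [^]\<^bsub>A.W\<^esub> q = \<one>\<^bsub>A.W\<^esub>"
    "b [^]\<^bsub>A.W\<^esub> q = \<one>\<^bsub>A.W\<^esub>" "(a \<otimes>\<^bsub>A.W\<^esub> b) [^]\<^bsub>A.W\<^esub> q \<noteq> \<one>\<^bsub>A.W\<^esub>"
    using A.product_has_larger_order[of 1] q by (auto simp: carrier_integer_mod_group)
  obtain s t where st: "s \<in> carrier B.W" "t \<in> carrier B.W"
    "(s \<otimes>\<^bsub>B.W\<^esub> inv\<^bsub>B.W\<^esub> t) [^]\<^bsub>B.W\<^esub> q = \<one>\<^bsub>B.W\<^esub>"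
    "(s [^]\<^bsub>B.W\<^esub> Suc q \<otimes>\<^bsub>B.W\<^esub> inv\<^bsub>B.W\<^esub> (t [^]\<^bsub>B.W\<^esub> Suc q)) [^]\<^bsub>B.W\<^esub> q \<noteq> \<one>\<^bsub>B.W\<^esub>"
    using B.power_changes_quotient_order[OF q ab] by blast
  have "q \<ge> 2" using q by simp
  from C.quotients_to_commutators[OF this st(1,2)] obtain x y
    where xy: "x \<in> carrier C.W" "y \<in> carrier C.W" and
    comm: "\<And>(k :: nat) (n :: nat). commutator C.W (x [^]\<^bsub>C.W\<^esub> k) y [^]\<^bsub>C.W\<^esub> n = \<one>\<^bsub>C.W\<^esub> \<longleftrightarrow>
      (s [^]\<^bsub>B.W\<^esub> k \<otimes>\<^bsub>B.W\<^esub> inv\<^bsub>B.W\<^esub> (t [^]\<^bsub>B.W\<^esub> k)) [^]\<^bsub>B.W\<^esub> n = \<one>\<^bsub>B.W\<^esub>"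
    by blast
  obtain N :: "nat monoid" and h where N: "group N" and h: "h \<in> iso C.W N"
    using C.W.exists_iso_nat_group[OF fin] by blast
  interpret N: group N by (rule N)
  interpret h: group_hom C.W N h
    using h by unfold_locales (auto simp: iso_def)
  have bij: "bij_betw h (carrier C.W) (carrier N)" using h by (simp add: iso_def)
  have eq_one: "h z = \<one>\<^bsub>N\<^esub> \<longleftrightarrow> z = \<one>\<^bsub>C.W\<^esub>" if "z \<in> carrier C.W" for z
    using bij_betw_imp_inj_on[OF bij] that by (metis C.W.one_closed h.hom_one inj_onD)
  have h_comm: "commutator N (h x [^]\<^bsub>N\<^esub> k) (h y) [^]\<^bsub>N\<^esub> n = \<one>\<^bsub>N\<^esub> \<longleftrightarrow>
      commutator C.W (x [^]\<^bsub>C.W\<^esub> k) y [^]\<^bsub>C.W\<^esub> n = \<one>\<^bsub>C.W\<^esub>" for k n :: nat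
  proof -
    have "commutator N (h x [^]\<^bsub>N\<^esub> k) (h y) [^]\<^bsub>N\<^esub> n = h (commutator C.W (x [^]\<^bsub>C.W\<^esub> k) y [^]\<^bsub>C.W\<^esub> n)"
      using xy by (simp add: commutator_def h.hom_nat_pow)
    then show ?thesis using eq_one xy by (simp add: commutator_def)
  qed
  show ?thesis
  proof (intro exI conjI)
    show "group N" by (rule N)
    show "finite (carrier N)" using bij fin by (simp add: bij_betw_finite)
    show "order N = p ^ n" using n bij by (simp add: order_def bij_betw_same_card)
    show "h x \<in> carrier N" "h y \<in> carrier N" using xy by auto
    show "p dvd q" by (simp add: q_def)
    show "commutator N (h x) (h y) [^]\<^bsub>N\<^esub> q = \<one>\<^bsub>N\<^esub>"
      using h_comm[of 1 q] comm[of 1 q] xy st(1-3) by (simp del: One_nat_def)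
    show "commutator N (h x [^]\<^bsub>N\<^esub> Suc q) (h y) [^]\<^bsub>N\<^esub> q \<noteq> \<one>\<^bsub>N\<^esub>"
      using h_comm[of "Suc q" q] comm[of "Suc q" q] st by simp
  qed
qed

lemma p_group_with_two_commutator_orders:
  fixes p :: nat
  assumes p: "prime p"
  shows "\<exists>(G :: nat monoid) x x' y. \<exists>n. group G \<and> finite (carrier G) \<and> order G = p ^ n \<and>
    x \<in> carrier G \<and> x' \<in> carrier G \<and> y \<in> carrier G \<and>
    generate G {x, y} = carrier G \<and> generate G {x', y} = carrier G \<and>
    group.ord G (commutator G x y) \<noteq> group.ord G (commutator G x' y)"
proof -
  obtain N :: "nat monoid" and x y q n where "group N" and fin: "finite (carrier N)"
    and n: "order N = p ^ n" and xy: "x \<in> carrier N" "y \<in> carrier N" and q: "p dvd q"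
    and comm: "commutator N x y [^]\<^bsub>N\<^esub> q = \<one>\<^bsub>N\<^esub>"
      "commutator N (x [^]\<^bsub>N\<^esub> Suc q) y [^]\<^bsub>N\<^esub> q \<noteq> \<one>\<^bsub>N\<^esub>"
    using wreath_tower[OF p] by blast
  interpret N: group N by fact
  let ?x = "x [^]\<^bsub>N\<^esub> Suc q"
  define H where "H = generate N {x, y}"
  have H: "subgroup H N" unfolding H_def using xy by (intro N.generate_is_subgroup) auto
  define G where "G = N\<lparr>carrier := H\<rparr>"
  have G: "group G" unfolding G_def by (rule N.subgroup_imp_group[OF H])
  interpret G: group G by (rule G)
  have "coprime (Suc q) p"
    using q coprime_divisors[of "Suc q" "Suc q" p q] by simp
  then have "coprime (Suc q) (order N)" using n by simp
  then have gen: "generate N {?x, y} = H"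
    unfolding H_def using N.generate_replace_by_coprime_power[OF xy fin] by blast
  have mem: "x \<in> H" "y \<in> H" unfolding H_def by (auto intro: generate.incl)
  have mem': "?x \<in> H" unfolding gen[symmetric] by (auto intro: generate.incl)
  have "card H dvd p ^ n"
    using N.lagrange[OF H] n by (metis dvd_triv_right)
  then obtain n' where n': "card H = p ^ n'" using divides_primepow_nat[OF p] by blast
  have comm_eq: "commutator G a b = commutator N a b" if "a \<in> H" "b \<in> H" for a b
    using that H N.m_inv_consistent[OF H]
    by (simp add: commutator_def G_def subgroup.m_closed)
  have comm_G: "commutator G a y \<in> carrier G" if "a \<in> H" for a
    using that mem unfolding commutator_def
    by (intro G.m_closed G.inv_closed) (simp_all add: G_def)
  have pow: "z [^]\<^bsub>G\<^esub> k = z [^]\<^bsub>N\<^esub> k" for z and k :: nat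
    unfolding G_def by (rule N.nat_pow_consistent[symmetric])
  have "G.ord (commutator G x y) dvd q" "\<not> G.ord (commutator G ?x y) dvd q"
    using comm comm_G mem mem'
    by (simp_all add: G.pow_eq_id[symmetric] pow comm_eq del: N.nat_pow_Suc) (simp_all add: G_def)
  then have "G.ord (commutator G x y) \<noteq> G.ord (commutator G ?x y)" by metis
  moreover have "generate G {x, y} = carrier G" "generate G {?x, y} = carrier G"
    using N.generate_consistent[OF _ H, of "{x, y}"] N.generate_consistent[OF _ H, of "{?x, y}"] mem mem' gen
    by (simp_all add: G_def H_def del: N.nat_pow_Suc)
  moreover have "finite (carrier G)" "order G = p ^ n'" "x \<in> carrier G" "?x \<in> carrier G" "y \<in> carrier G"
    using mem mem' n' finite_subset[OF subgroup.subset[OF H] fin] by (simp_all add: G_def order_def)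
  ultimately show ?thesis using G by blast
qed

section \<open>The origami of a generating pair\<close>

definition group_origami :: "('a, 'b) monoid_scheme \<Rightarrow> 'a \<Rightarrow> 'a \<Rightarrow> 'a origami" where
  "group_origami G x y =
     \<lparr>squares = carrier G, right_of = \<lambda>g. g \<otimes>\<^bsub>G\<^esub> x, up_of = \<lambda>g. g \<otimes>\<^bsub>G\<^esub> y\<rparr>"

lemma topspace_disjoint_squares: "topspace (disjoint_squares X) = squares X \<times> unit_square"
  by (simp add: disjoint_squares_def)

lemma openin_disjoint_squares:
  "openin (disjoint_squares X) U \<longleftrightarrow>
     U \<subseteq> squares X \<times> unit_square \<and> (\<forall>s\<in>squares X. openin (top_of_set unit_square) {z. (s, z) \<in> U})"
proof (intro iffI conjI ballI)
  assume U: "openin (disjoint_squares X) U"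
  show "U \<subseteq> squares X \<times> unit_square"
    using openin_subset[OF U] by (simp add: topspace_disjoint_squares)
  fix s assume s: "s \<in> squares X"
  have "continuous_map (top_of_set unit_square) (disjoint_squares X) (\<lambda>z. (s, z))"
    unfolding disjoint_squares_def using s
    by (intro continuous_map_pairedI) (auto simp: continuous_map_const)
  from openin_continuous_map_preimage[OF this U]
  have "openin (top_of_set unit_square) {z \<in> unit_square. (s, z) \<in> U}" by simp
  also have "{z \<in> unit_square. (s, z) \<in> U} = {z. (s, z) \<in> U}"
    using \<open>U \<subseteq> _\<close> by auto
  finally show "openin (top_of_set unit_square) {z. (s, z) \<in> U}" .
next
  assume U: "U \<subseteq> squares X \<times> unit_square \<and>
    (\<forall>s\<in>squares X. openin (top_of_set unit_square) {z. (s, z) \<in> U})"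
  show "openin (disjoint_squares X) U"
    unfolding disjoint_squares_def openin_prod_topology_alt
  proof (intro allI impI)
    fix s z assume "(s, z) \<in> U"
    then show "\<exists>V W. openin (discrete_topology (squares X)) V \<and> openin (top_of_set unit_square) W \<and>
        s \<in> V \<and> z \<in> W \<and> V \<times> W \<subseteq> U"
      using U by (intro exI[of _ "{s}"] exI[of _ "{z. (s, z) \<in> U}"]) auto
  qed
qed

definition glue_class :: "'a origami \<Rightarrow> 'a \<times> (real \<times> real) \<Rightarrow> ('a \<times> (real \<times> real)) set" where
  "glue_class X w = glue_equiv X `` {w}"

lemma points_eq: "points X = glue_class X ` (squares X \<times> unit_square)"
  by (auto simp: points_def quotient_def glue_class_def topspace_disjoint_squares)

lemma glue_class_self: "w \<in> glue_class X w"
  by (simp add: glue_class_def glue_equiv_def)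

lemma glue_class_eq_iff: "glue_class X w = glue_class X w' \<longleftrightarrow> (w, w') \<in> glue_equiv X"
  using eq_equiv_class_iff[OF equiv_glue_equiv[of X], of w w'] by (simp add: glue_class_def)

lemma glue_class_eqI: "(w, w') \<in> glue X \<Longrightarrow> glue_class X w = glue_class X w'"
  by (auto simp: glue_class_eq_iff glue_equiv_def)

lemma glue_class_mem: "w' \<in> glue_class X w \<Longrightarrow> glue_class X w' = glue_class X w"
  using glue_class_eq_iff[of X w w'] by (simp add: glue_class_def)

section \<open>Neighbourhoods of points in the unit interval\<close>

text \<open>One factor of an open star: the half interval at an endpoint, and the whole open interval at an
  interior point. With this choice (rather than small balls) stars are compatible with the gluing
  without any choice of radii.\<close>

definition star_interval :: "real \<Rightarrow> real set" where
  "star_interval a = (if a = 0 then {0..<1/2} else if a = 1 then {1/2<..1} else {0<..<1})"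

lemma star_interval_self: "a \<in> {0..1} \<Longrightarrow> a \<in> star_interval a"
  by (auto simp: star_interval_def)

lemma zero_in_star_interval: "a \<in> {0..1} \<Longrightarrow> 0 \<in> star_interval a \<longleftrightarrow> a = 0"
  and one_in_star_interval: "a \<in> {0..1} \<Longrightarrow> 1 \<in> star_interval a \<longleftrightarrow> a = 1"
  by (auto simp: star_interval_def)

lemma star_interval_subset: "star_interval a \<subseteq> {0..1}"
  by (auto simp: star_interval_def)

lemma openin_star_interval: "openin (top_of_set {0..1}) (star_interval a)"
proof -
  have "star_interval a = {0..1} \<inter> (if a = 0 then {..<1/2} else if a = 1 then {1/2<..} else {0<..<1})"
    by (auto simp: star_interval_def)
  moreover have "open (if a = 0 then {..<1/2} else if a = 1 then {1/2<..} else {0<..<1::real})"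
    by auto
  ultimately show ?thesis by (metis openin_open_Int)
qed

lemma cis_2pi_eq_imp:
  assumes "u \<in> {0..1}" "u' \<in> {0..1}" "cis (2 * pi * u) = cis (2 * pi * u')"
  shows "u = u' \<or> {u, u'} = {0, 1}"
proof -
  have "sin (2 * pi * u) = sin (2 * pi * u') \<and> cos (2 * pi * u) = cos (2 * pi * u')"
    using assms(3) by (metis cis.sel)
  then obtain n :: int where "2 * pi * u = 2 * pi * u' + 2 * of_int n * pi"
    unfolding sin_cos_eq_iff by (auto simp: mult.commute)
  then have "pi * (u - u' - of_int n) = 0" by (simp add: algebra_simps)
  then have n: "u - u' = of_int n" by simp
  then have "real_of_int n \<le> 1" "real_of_int n \<ge> -1" using assms(1,2) by auto
  then have "n = -1 \<or> n = 0 \<or> n = 1" by linarith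
  then show ?thesis using n assms(1,2) by auto
qed

lemma star_intervals_meet:
  assumes "a \<in> {0..1}" "b \<in> {0..1}" "cis (2 * pi * a) = cis (2 * pi * b)"
    and "u \<in> star_interval a" "u \<in> star_interval b"
  shows "a = b"
  using cis_2pi_eq_imp[OF assms(1-3)] assms(4,5)
  by (auto simp: star_interval_def doubleton_eq_iff)

lemma star_interval_inj:
  assumes "u \<in> star_interval a" "v \<in> star_interval a" "cis (2 * pi * u) = cis (2 * pi * v)"
  shows "u = v"
proof -
  have "u \<in> {0..1}" "v \<in> {0..1}" using assms(1,2) star_interval_subset by blast+
  from cis_2pi_eq_imp[OF this assms(3)] assms(1,2) show ?thesis
    by (auto simp: star_interval_def doubleton_eq_iff split: if_splits)
qed

lemma star_interval_opposite:
  assumes "u \<in> star_interval 1" "v \<in> star_interval 0" "cis (2 * pi * u) = cis (2 * pi * v)"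
  shows "u = 1 \<and> v = 0"
proof -
  have "u \<in> {0..1}" "v \<in> {0..1}" using assms(1,2) star_interval_subset by blast+
  from cis_2pi_eq_imp[OF this assms(3)] assms(1,2) show ?thesis
    by (auto simp: star_interval_def doubleton_eq_iff)
qed

section \<open>Points of the surface\<close>

locale two_generated_group = group G for G (structure) +
  fixes x y
  assumes fin: "finite (carrier G)" and x: "x \<in> carrier G" and y: "y \<in> carrier G"
    and gen: "generate G {x, y} = carrier G"
begin

abbreviation X where "X \<equiv> group_origami G x y"
abbreviation sqs where "sqs \<equiv> carrier G \<times> unit_square"
abbreviation cls where "cls \<equiv> glue_class X"

lemma squares_X [simp]: "squares X = carrier G"
  and right_of_X [simp]: "right_of X = (\<lambda>g. g \<otimes> x)"
  and up_of_X [simp]: "up_of X = (\<lambda>g. g \<otimes> y)"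
  by (simp_all add: group_origami_def)

lemmas xy_closed [simp] = x y

lemma points_X: "points X = cls ` sqs"
  by (simp add: points_eq)

text \<open>The connectedness of the Cayley graph of \<open>G\<close>.\<close>

lemma generated_induct:
  assumes s: "s \<in> carrier G" "s \<in> S"
    and "\<And>s. s \<in> carrier G \<Longrightarrow> s \<otimes> x \<in> S \<longleftrightarrow> s \<in> S"
    and "\<And>s. s \<in> carrier G \<Longrightarrow> s \<otimes> y \<in> S \<longleftrightarrow> s \<in> S"
    and t: "t \<in> carrier G"
  shows "t \<in> S"
proof -
  have "s \<otimes> h \<in> S \<longleftrightarrow> s \<in> S" if "h \<in> generate G {x, y}" "s \<in> carrier G" for h s
    using that
  proof (induction arbitrary: s rule: generate.induct)
    case one
    then show ?case by simp
  next
    case (incl h)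
    then show ?case using assms by auto
  next
    case (inv h)
    then have h: "h \<in> carrier G" by auto
    have "s \<otimes> inv h \<otimes> h \<in> S \<longleftrightarrow> s \<otimes> inv h \<in> S"
      using inv assms(3,4)[of "s \<otimes> inv h"] by auto
    then show ?case using inv h by (simp add: m_assoc)
  next
    case (eng h k)
    then have "h \<in> carrier G" "k \<in> carrier G" using gen by auto
    then show ?case using eng by (simp add: m_assoc[symmetric])
  qed
  from this[of "inv s \<otimes> t" s] show ?thesis using s t gen by (simp add: m_assoc[symmetric])
qed

text \<open>A full turn around the lower left corner of the square \<open>s\<close> leads to the square \<open>s turn\<close>.\<close>

definition turn where "turn = commutator G x y"
definition turns where "turns = generate G {turn}"

lemma turn_closed [simp]: "turn \<in> carrier G" by (simp add: turn_def commutator_def)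

lemma turns_subgroup: "subgroup turns G" unfolding turns_def by (intro generate_is_subgroup) auto

lemma turns_subset: "turns \<subseteq> carrier G" using turns_subgroup by (rule subgroup.subset)

lemma xy_eq_yx_turn: "x \<otimes> y = y \<otimes> x \<otimes> turn"
  by (simp add: turn_def commutator_def m_assoc[symmetric])

lemma turn_coset_absorb: "b \<in> carrier G \<Longrightarrow> (b \<otimes> turn) <# turns = b <# turns"
proof -
  assume b: "b \<in> carrier G"
  have "turn \<in> turns" unfolding turns_def by (auto intro: generate.incl)
  then have "turn <# turns = turns" using coset_join3[OF _ turns_subgroup] by simp
  then show ?thesis using lcos_m_assoc[OF turns_subset b turn_closed] by simp
qed

text \<open>Edges at coordinate 1 are identified with edges at coordinate 0 of a neighbouring square.
  Sending a point to its representative with coordinates below 1 is well defined, except that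
  a corner has one such representative for each element of a coset of \<open>turns\<close>. The resulting
  \<open>point_label\<close> is a complete invariant of the gluing class (\<open>cls_eq\<close>).\<close>

definition frac01 :: "real \<Rightarrow> real" where "frac01 u = (if u = 1 then 0 else u)"

definition base :: "'a \<times> (real \<times> real) \<Rightarrow> 'a" where
  "base w = (case w of (s, (u, v)) \<Rightarrow> s \<otimes> (if u = 1 then x else \<one>) \<otimes> (if v = 1 then y else \<one>))"

definition point_label :: "'a \<times> (real \<times> real) \<Rightarrow> 'a set \<times> real \<times> real" where
  "point_label w = (case w of (s, (u, v)) \<Rightarrow>
     (base w <# (if frac01 u = 0 \<and> frac01 v = 0 then turns else {\<one>}), frac01 u, frac01 v))"

lemma base_closed: "w \<in> sqs \<Longrightarrow> base w \<in> carrier G"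
  by (auto simp: base_def)

lemma point_label_glue:
  assumes "(w, w') \<in> glue X"
  shows "point_label w = point_label w'"
  using assms unfolding glue_def
proof (elim UnE CollectE exE conjE)
  fix s t assume h: "(w, w') = ((s, (1, t)), (right_of X s, (0, t)))" "s \<in> squares X" "t \<in> {0..1}"
  then show ?thesis by (auto simp: point_label_def base_def frac01_def)
next
  fix s t assume h: "(w, w') = ((s, (t, 1)), (up_of X s, (t, 0)))" "s \<in> squares X" "t \<in> {0..1}"
  have "s \<otimes> x \<otimes> y = s \<otimes> y \<otimes> x \<otimes> turn" using h xy_eq_yx_turn by (simp add: m_assoc)
  then show ?thesis using h turn_coset_absorb[of "s \<otimes> y \<otimes> x"]
    by (auto simp: point_label_def base_def frac01_def)
qed

lemma glue_sqs: "(w, w') \<in> glue X \<Longrightarrow> w \<in> sqs \<and> w' \<in> sqs"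
  by (auto simp: glue_def)

lemma glue_right: "s \<in> carrier G \<Longrightarrow> t \<in> {0..1} \<Longrightarrow> cls (s, (1, t)) = cls (s \<otimes> x, (0, t))"
  and glue_up: "s \<in> carrier G \<Longrightarrow> t \<in> {0..1} \<Longrightarrow> cls (s, (t, 1)) = cls (s \<otimes> y, (t, 0))"
  by (auto intro!: glue_class_eqI simp: glue_def)

lemma glue_equiv_point_label: "(w, w') \<in> glue_equiv X \<Longrightarrow> w \<in> sqs \<Longrightarrow> w' \<in> sqs \<and> point_label w' = point_label w"
  unfolding glue_equiv_def
  by (induction rule: rtrancl_induct) (auto dest: point_label_glue glue_sqs)

lemma cls_base:
  assumes "(s, (u, v)) \<in> sqs"
  shows "cls (s, (u, v)) = cls (base (s, (u, v)), (frac01 u, frac01 v))"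
  using assms glue_right[of s v] glue_up[of s u] glue_up[of "s \<otimes> x" 0]
  by (auto simp: base_def frac01_def)

text \<open>The squares \<open>t x y\<close> and \<open>t y x\<close> both touch, with their lower left corners, the upper right corner
  of \<open>t\<close>.\<close>

lemma cls_corner_turn: "s \<in> carrier G \<Longrightarrow> cls (s \<otimes> turn, (0, 0)) = cls (s, (0, 0))"
proof -
  assume s: "s \<in> carrier G"
  define t where "t = s \<otimes> inv (y \<otimes> x)"
  have t: "t \<in> carrier G" "s = t \<otimes> y \<otimes> x" "s \<otimes> turn = t \<otimes> x \<otimes> y"
  proof -
    show t: "t \<in> carrier G" using s by (simp add: t_def)
    have "t \<otimes> (y \<otimes> x) = s" using s by (simp add: t_def m_assoc)
    then show 1: "s = t \<otimes> y \<otimes> x" using t by (simp add: m_assoc)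
    have "s \<otimes> turn = t \<otimes> (y \<otimes> x \<otimes> turn)" using t by (simp add: 1 m_assoc)
    then show "s \<otimes> turn = t \<otimes> x \<otimes> y" using t by (simp add: m_assoc flip: xy_eq_yx_turn)
  qed
  have "cls (t \<otimes> x \<otimes> y, (0, 0)) = cls (t, (1, 1))"
    using glue_right[of t 1] glue_up[of "t \<otimes> x" 0] t by simp
  also have "\<dots> = cls (t \<otimes> y \<otimes> x, (0, 0))"
    using glue_up[of t 1] glue_right[of "t \<otimes> y" 0] t by simp
  finally show ?thesis using t by simp
qed

lemma cls_corner_coset: "d \<in> turns \<Longrightarrow> s \<in> carrier G \<Longrightarrow> cls (s \<otimes> d, (0, 0)) = cls (s, (0, 0))"
proof -
  assume "d \<in> turns" and s: "s \<in> carrier G"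
  then obtain k :: nat where d: "d = turn [^] k"
    using generate_pow_on_finite_carrier[OF fin turn_closed] by (auto simp: turns_def)
  have "cls (s \<otimes> turn [^] k, (0, 0)) = cls (s, (0, 0))" for k :: nat
  proof (induction k)
    case (Suc k)
    then show ?case using cls_corner_turn[of "s \<otimes> turn [^] k"] s by (simp add: m_assoc)
  qed (use s in simp)
  then show ?thesis using d by simp
qed

lemma cls_eq_iff: "w \<in> sqs \<Longrightarrow> w' \<in> sqs \<Longrightarrow> cls w = cls w' \<longleftrightarrow> point_label w = point_label w'"
proof
  assume w: "w \<in> sqs" "w' \<in> sqs" and l: "point_label w = point_label w'"
  obtain s u v s' u' v' where e: "w = (s, (u, v))" "w' = (s', (u', v'))" by (metis prod.collapse)
  let ?b = "base w" and ?b' = "base w'"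
  have b: "?b \<in> carrier G" "?b' \<in> carrier G" using w base_closed by blast+
  have f: "frac01 u = frac01 u'" "frac01 v = frac01 v'" using l e by (auto simp: point_label_def)
  have "cls (?b, (frac01 u, frac01 v)) = cls (?b', (frac01 u, frac01 v))"
  proof (cases "frac01 u = 0 \<and> frac01 v = 0")
    case True
    then have "?b <# turns = ?b' <# turns" using l e f by (simp add: point_label_def)
    then have "?b' \<in> ?b <# turns" using lcos_self[OF b(2) turns_subgroup] by simp
    then obtain d where "d \<in> turns" "?b' = ?b \<otimes> d" by (auto simp: l_coset_def)
    then show ?thesis using True cls_corner_coset[of d ?b] b by simp
  next
    case False
    then have "?b <# {\<one>} = ?b' <# {\<one>}" using l e f by (auto simp: point_label_def)
    then show ?thesis using b by (simp add: l_coset_def)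
  qed
  then show "cls w = cls w'" using cls_base w e f by metis
next
  assume w: "w \<in> sqs" "w' \<in> sqs" and "cls w = cls w'"
  then show "point_label w = point_label w'" using glue_equiv_point_label by (simp add: glue_class_eq_iff)
qed

lemma cls_eq: "w \<in> sqs \<Longrightarrow> cls w = {w' \<in> sqs. point_label w' = point_label w}"
proof (intro equalityI subsetI)
  fix w' assume w: "w \<in> sqs" "w' \<in> cls w"
  then have "(w, w') \<in> glue_equiv X" by (simp add: glue_class_def)
  then show "w' \<in> {w' \<in> sqs. point_label w' = point_label w}" using glue_equiv_point_label w by blast
next
  fix w' assume w: "w \<in> sqs" "w' \<in> {w' \<in> sqs. point_label w' = point_label w}"
  then have "cls w' = cls w" using cls_eq_iff by blast
  then show "w' \<in> cls w" using glue_class_self by metis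
qed

lemma point_subset: "P \<in> points X \<Longrightarrow> P \<subseteq> sqs"
  unfolding points_X using cls_eq by blast

lemma point_eq_cls: "P \<in> points X \<Longrightarrow> w \<in> P \<Longrightarrow> w \<in> sqs \<and> P = cls w"
  using point_subset[of P] glue_class_mem[of w X] unfolding points_X by blast

section \<open>Connectedness of the surface\<close>

lemma openin_surfaceI:
  assumes "U \<subseteq> points X"
    "\<And>s. s \<in> carrier G \<Longrightarrow> openin (top_of_set unit_square) {z \<in> unit_square. cls (s, z) \<in> U}"
  shows "openin (surface X) U"
proof -
  have "{z. (s, z) \<in> \<Union>U} = {z \<in> unit_square. cls (s, z) \<in> U}" if s: "s \<in> carrier G" for s
  proof (intro equalityI subsetI)
    fix z assume "z \<in> {z. (s, z) \<in> \<Union>U}"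
    then show "z \<in> {z \<in> unit_square. cls (s, z) \<in> U}" using assms(1) point_eq_cls by blast
  next
    fix z assume "z \<in> {z \<in> unit_square. cls (s, z) \<in> U}"
    then show "z \<in> {z. (s, z) \<in> \<Union>U}" using glue_class_self by blast
  qed
  moreover have "\<Union>U \<subseteq> sqs" using assms(1) point_subset by blast
  ultimately show ?thesis
    using assms by (auto simp: openin_surface openin_disjoint_squares)
qed

lemma openin_surfaceD:
  assumes "openin (surface X) U" "s \<in> carrier G"
  shows "openin (top_of_set unit_square) {z \<in> unit_square. cls (s, z) \<in> U}"
proof -
  have U: "U \<subseteq> points X" using assms by (simp add: openin_surface)
  have "{z. (s, z) \<in> \<Union>U} = {z \<in> unit_square. cls (s, z) \<in> U}"
  proof (intro equalityI subsetI)
    fix z assume "z \<in> {z. (s, z) \<in> \<Union>U}"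
    then show "z \<in> {z \<in> unit_square. cls (s, z) \<in> U}" using U point_eq_cls by blast
  next
    fix z assume "z \<in> {z \<in> unit_square. cls (s, z) \<in> U}"
    then show "z \<in> {z. (s, z) \<in> \<Union>U}" using glue_class_self by blast
  qed
  then show ?thesis using assms by (auto simp: openin_surface openin_disjoint_squares)
qed

lemma topspace_surface: "topspace (surface X) = points X"
proof
  show "topspace (surface X) \<subseteq> points X"
    using openin_surface[of X "topspace (surface X)"] by simp
  have "{z \<in> unit_square. cls (s, z) \<in> points X} = unit_square" if "s \<in> carrier G" for s
    using that by (auto simp: points_X)
  then have "openin (surface X) (points X)" by (intro openin_surfaceI) auto
  then show "points X \<subseteq> topspace (surface X)" by (rule openin_subset)
qed

text \<open>A clopen set contains all of a square or nothing of it, and the same for neighbouring squares.\<close>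

lemma connected_surface: "connected_space (surface X)"
  unfolding connected_space_clopen_in
proof (intro allI impI)
  fix U assume U: "openin (surface X) U \<and> closedin (surface X) U"
  let ?S = "\<lambda>s. {z \<in> unit_square. cls (s, z) \<in> U}"
  define T where "T = {s. ?S s = unit_square}"
  have conn: "connected unit_square"
    by (intro connected_Times) auto
  have dich: "?S s = {} \<or> ?S s = unit_square" if s: "s \<in> carrier G" for s
  proof -
    have "openin (surface X) (points X - U)" using U by (simp add: closedin_def topspace_surface)
    from openin_surfaceD[OF this s]
    have "openin (top_of_set unit_square) {z \<in> unit_square. cls (s, z) \<in> points X - U}" .
    also have "{z \<in> unit_square. cls (s, z) \<in> points X - U} = unit_square - ?S s"
      using s by (auto simp: points_X)
    finally have "closedin (top_of_set unit_square) (?S s)"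
      by (auto simp: closedin_def)
    then show ?thesis using openin_surfaceD[of U s] U s conn by (auto simp: connected_clopen)
  qed
  have T: "s \<in> T \<longleftrightarrow> cls (s, z) \<in> U" if "s \<in> carrier G" "z \<in> unit_square" for s z
    using dich[OF that(1)] that(2) unfolding T_def by auto
  have 1: "s \<otimes> x \<in> T \<longleftrightarrow> s \<in> T" if "s \<in> carrier G" for s
    using T[of s "(1, 0)"] T[of "s \<otimes> x" "(0, 0)"] glue_right[of s 0] that by simp
  have 2: "s \<otimes> y \<in> T \<longleftrightarrow> s \<in> T" if "s \<in> carrier G" for s
    using T[of s "(0, 1)"] T[of "s \<otimes> y" "(0, 0)"] glue_up[of s 0] that by simp
  show "U = {} \<or> U = topspace (surface X)"
  proof (cases "U = {}")
    case False
    have "U \<subseteq> points X" using U by (simp add: openin_surface)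
    moreover from False obtain P where "P \<in> U" by blast
    ultimately obtain s z where s: "s \<in> carrier G" "z \<in> unit_square" "cls (s, z) \<in> U"
      unfolding points_X by blast
    then have "s \<in> T" using T by blast
    then have "t \<in> T" if "t \<in> carrier G" for t
      using generated_induct[of s T t] 1 2 s that by blast
    then have "points X \<subseteq> U" using T by (auto simp: points_X)
    then show ?thesis using \<open>U \<subseteq> points X\<close> by (simp add: topspace_surface)
  qed simp
qed

lemma is_origami_X: "is_origami X"
proof -
  have "bij_betw (\<lambda>g. g \<otimes> a) (carrier G) (carrier G)" if "a \<in> carrier G" for a
    using that by (intro bij_betw_byWitness[of _ "\<lambda>g. g \<otimes> inv a"]) (auto simp: m_assoc)
  then show ?thesis using fin connected_surface by (auto simp: is_origami_def)
qed



section \<open>Stars\<close>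

definition star :: "('a \<times> (real \<times> real)) set \<Rightarrow> ('a \<times> (real \<times> real)) set" where
  "star P = {(s, (u, v)) | s u v. \<exists>a b. (s, (a, b)) \<in> P \<and> u \<in> star_interval a \<and> v \<in> star_interval b}"

definition nbhd :: "('a \<times> (real \<times> real)) set \<Rightarrow> ('a \<times> (real \<times> real)) set set" where
  "nbhd P = {Q \<in> points X. \<exists>w\<in>Q. w \<in> star P}"

lemma starE:
  assumes "P \<in> points X" "(s, (u, v)) \<in> star P"
  obtains a b where "(s, (a, b)) \<in> P" "s \<in> carrier G" "a \<in> {0..1}" "b \<in> {0..1}"
    "u \<in> star_interval a" "v \<in> star_interval b"
proof -
  obtain a b where "(s, (a, b)) \<in> P" "u \<in> star_interval a" "v \<in> star_interval b"
    using assms(2) by (auto simp: star_def)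
  moreover from this have "(s, (a, b)) \<in> sqs" using point_subset[OF assms(1)] by blast
  ultimately show ?thesis using that by auto
qed

lemma cls_mem_point: "P \<in> points X \<Longrightarrow> w \<in> P \<Longrightarrow> cls w = cls w' \<Longrightarrow> w' \<in> P"
  using point_eq_cls glue_class_self by metis

text \<open>A glued edge meets the star of \<open>P\<close> only near representatives of \<open>P\<close> on that edge, and these are
  glued along with the edge.\<close>

lemma star_glue:
  assumes P: "P \<in> points X" and g: "(w, w') \<in> glue X"
  shows "w \<in> star P \<longleftrightarrow> w' \<in> star P"
  using g unfolding glue_def
proof (elim UnE CollectE exE conjE)
  fix s t assume "(w, w') = ((s, (1, t)), (right_of X s, (0, t)))" "s \<in> squares X" "t \<in> {0..1}"
  then have w: "w = (s, (1, t))" "w' = (s \<otimes> x, (0, t))" and s: "s \<in> carrier G" by auto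
  show ?thesis unfolding w
  proof
    assume "(s, (1, t)) \<in> star P"
    then obtain a b where ab: "(s, (a, b)) \<in> P" "a \<in> {0..1}" "b \<in> {0..1}"
      "1 \<in> star_interval a" "t \<in> star_interval b" by (rule starE[OF P])
    then have "a = 1" by (simp add: one_in_star_interval)
    then have "(s \<otimes> x, (0, b)) \<in> P"
      using ab s glue_right[of s b] by (blast intro: cls_mem_point[OF P])
    then show "(s \<otimes> x, (0, t)) \<in> star P"
      using ab zero_in_star_interval[of 0] unfolding star_def by auto
  next
    assume "(s \<otimes> x, (0, t)) \<in> star P"
    then obtain a b where ab: "(s \<otimes> x, (a, b)) \<in> P" "a \<in> {0..1}" "b \<in> {0..1}"
      "0 \<in> star_interval a" "t \<in> star_interval b" by (rule starE[OF P])
    then have "a = 0" by (simp add: zero_in_star_interval)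
    then have "(s, (1, b)) \<in> P"
      using ab s glue_right[of s b, symmetric] by (blast intro: cls_mem_point[OF P])
    then show "(s, (1, t)) \<in> star P"
      using ab one_in_star_interval[of 1] unfolding star_def by auto
  qed
next
  fix s t assume "(w, w') = ((s, (t, 1)), (up_of X s, (t, 0)))" "s \<in> squares X" "t \<in> {0..1}"
  then have w: "w = (s, (t, 1))" "w' = (s \<otimes> y, (t, 0))" and s: "s \<in> carrier G" by auto
  show ?thesis unfolding w
  proof
    assume "(s, (t, 1)) \<in> star P"
    then obtain a b where ab: "(s, (a, b)) \<in> P" "a \<in> {0..1}" "b \<in> {0..1}"
      "t \<in> star_interval a" "1 \<in> star_interval b" by (rule starE[OF P])
    then have "b = 1" by (simp add: one_in_star_interval)
    then have "(s \<otimes> y, (a, 0)) \<in> P"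
      using ab s glue_up[of s a] by (blast intro: cls_mem_point[OF P])
    then show "(s \<otimes> y, (t, 0)) \<in> star P"
      using ab zero_in_star_interval[of 0] unfolding star_def by auto
  next
    assume "(s \<otimes> y, (t, 0)) \<in> star P"
    then obtain a b where ab: "(s \<otimes> y, (a, b)) \<in> P" "a \<in> {0..1}" "b \<in> {0..1}"
      "t \<in> star_interval a" "0 \<in> star_interval b" by (rule starE[OF P])
    then have "b = 0" by (simp add: zero_in_star_interval)
    then have "(s, (a, 1)) \<in> P"
      using ab s glue_up[of s a, symmetric] by (blast intro: cls_mem_point[OF P])
    then show "(s, (t, 1)) \<in> star P"
      using ab one_in_star_interval[of 1] unfolding star_def by auto
  qed
qed

lemma star_saturated:
  assumes P: "P \<in> points X" and "cls w = cls w'"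
  shows "w \<in> star P \<longleftrightarrow> w' \<in> star P"
proof -
  have "(w, w') \<in> (glue X \<union> (glue X)\<inverse>)\<^sup>*"
    using assms(2) by (simp add: glue_class_eq_iff glue_equiv_def)
  then show ?thesis
    by (induction rule: rtrancl_induct) (auto simp: star_glue[OF P])
qed

lemma cls_in_nbhd_iff:
  assumes P: "P \<in> points X" and w: "w \<in> sqs"
  shows "cls w \<in> nbhd P \<longleftrightarrow> w \<in> star P"
proof
  assume "cls w \<in> nbhd P"
  then obtain w' where "w' \<in> cls w" "w' \<in> star P" by (auto simp: nbhd_def)
  then show "w \<in> star P" using star_saturated[OF P, of w' w] glue_class_mem by blast
next
  assume "w \<in> star P"
  then show "cls w \<in> nbhd P" using w glue_class_self unfolding nbhd_def points_X by blast
qed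

lemma openin_nbhd:
  assumes P: "P \<in> points X"
  shows "openin (surface X) (nbhd P)"
proof (rule openin_surfaceI)
  show "nbhd P \<subseteq> points X" by (auto simp: nbhd_def)
  fix s assume s: "s \<in> carrier G"
  have "{z \<in> unit_square. cls (s, z) \<in> nbhd P} = {z \<in> unit_square. (s, z) \<in> star P}"
    using cls_in_nbhd_iff[OF P] s by blast
  also have "\<dots> = (\<Union>(a, b)\<in>{(a, b). (s, (a, b)) \<in> P}. star_interval a \<times> star_interval b)"
    using star_interval_subset by (fastforce simp: star_def)
  finally show "openin (top_of_set unit_square) {z \<in> unit_square. cls (s, z) \<in> nbhd P}"
    by (auto intro!: openin_Union openin_Times openin_star_interval)
qed

lemma self_in_nbhd:
  assumes P: "P \<in> points X"
  shows "P \<in> nbhd P"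
proof -
  obtain s a b where P': "P = cls (s, (a, b))" "(s, (a, b)) \<in> sqs" using P by (auto simp: points_X)
  then have "(s, (a, b)) \<in> star P"
    using glue_class_self[of "(s, (a, b))" X] star_interval_self[of a] star_interval_self[of b]
    unfolding star_def by auto
  then show ?thesis using P' glue_class_self P unfolding nbhd_def by blast
qed

lemma torus_proj_frac01: "torus_proj (frac01 u, frac01 v) = torus_proj (u, v)"
  by (auto simp: torus_proj_def frac01_def complex_eq_iff)

lemma covering_cls:
  assumes "w \<in> sqs"
  shows "covering X (cls w) = torus_proj (snd w)"
proof -
  have "(\<lambda>(s, z). torus_proj z) w' = torus_proj (snd w)" if "w' \<in> cls w" for w'
  proof -
    have "point_label w' = point_label w" using that cls_eq[OF assms] by blast
    then have "frac01 (fst (snd w')) = frac01 (fst (snd w))" "frac01 (snd (snd w')) = frac01 (snd (snd w))"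
      by (auto simp: point_label_def split: prod.splits)
    then have "torus_proj (snd w') = torus_proj (snd w)"
      by (metis torus_proj_frac01 prod.collapse)
    then show ?thesis by (simp add: split_beta)
  qed
  then have "(\<lambda>(s, z). torus_proj z) ` cls w = {torus_proj (snd w)}"
    using glue_class_self[of w X] by (auto simp del: split_paired_All)
  then show ?thesis unfolding covering_def by simp
qed

text \<open>In a common square, two representatives over the same point of the torus could differ only in
  coordinates that are 0 for one and 1 for the other, but the intervals at 0 and 1 are disjoint.\<close>

lemma stars_disjoint:
  assumes P: "P \<in> points X" and Q: "Q \<in> points X" and cov: "covering X P = covering X Q"
    and R: "R \<in> nbhd P" "R \<in> nbhd Q"
  shows "P = Q"
proof -
  obtain w where w: "w \<in> sqs" "R = cls w" using R by (auto simp: nbhd_def points_X)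
  obtain s u v where e: "w = (s, (u, v))" by (metis prod.collapse)
  have "(s, (u, v)) \<in> star P" "(s, (u, v)) \<in> star Q" using R w e cls_in_nbhd_iff P Q by blast+
  then obtain a b a' b' where ab: "(s, (a, b)) \<in> P" "a \<in> {0..1}" "b \<in> {0..1}" "s \<in> carrier G"
    "u \<in> star_interval a" "v \<in> star_interval b"
    and ab': "(s, (a', b')) \<in> Q" "a' \<in> {0..1}" "b' \<in> {0..1}"
    "u \<in> star_interval a'" "v \<in> star_interval b'"
    by (metis starE[OF P] starE[OF Q])
  have PQ: "P = cls (s, (a, b))" "Q = cls (s, (a', b'))" using ab ab' point_eq_cls P Q by blast+
  then have "torus_proj (a, b) = torus_proj (a', b')"
    using cov covering_cls[of "(s, (a, b))"] covering_cls[of "(s, (a', b'))"] ab ab' by simp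
  then have "a = a'" "b = b'"
    using star_intervals_meet ab ab' by (auto simp: torus_proj_def)
  then show ?thesis using PQ by simp
qed

text \<open>The unit square without its corners; as the union of two products of intervals it is
  visibly connected.\<close>

definition punctured_square :: "(real \<times> real) set" where
  "punctured_square = {0<..<1} \<times> {0..1} \<union> {0..1} \<times> {0<..<1}"

lemma punctured_square_subset: "punctured_square \<subseteq> unit_square" by (auto simp: punctured_square_def)

lemma connected_punctured_square: "connected punctured_square"
  unfolding punctured_square_def
proof (rule connected_Un)
  have "(1/2, 1/2) \<in> ({0<..<1} \<times> {0..1}) \<inter> ({0..1} \<times> {0<..<1}) \<inter> (UNIV :: (real \<times> real) set)"
    by simp
  then show "({0<..<1} \<times> {0..1}) \<inter> ({0..1} \<times> {0<..<1}) \<noteq> ({} :: (real \<times> real) set)" by blast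
qed (auto intro: connected_Times)

text \<open>Away from the corners the star of a point consists of one open square or of two
  half squares glued along an edge, and two points over the same point of the torus can be
  in different halves only on this edge.
  For a corner the statement fails: its star is a branched cover.\<close>

lemma star_injective:
  assumes q: "(s, (a, b)) \<in> sqs" "(a, b) \<in> punctured_square"
    and R: "R\<^sub>1 \<in> nbhd (cls (s, (a, b)))" "R\<^sub>2 \<in> nbhd (cls (s, (a, b)))"
    and cov: "covering X R\<^sub>1 = covering X R\<^sub>2"
  shows "R\<^sub>1 = R\<^sub>2"
proof -
  let ?Q = "cls (s, (a, b))"
  have Q: "?Q \<in> points X" using q by (auto simp: points_X)
  obtain s1 u1 v1 where w1: "(s1, (u1, v1)) \<in> sqs" "R\<^sub>1 = cls (s1, (u1, v1))"
    using R(1) by (auto simp: nbhd_def points_X)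
  obtain s2 u2 v2 where w2: "(s2, (u2, v2)) \<in> sqs" "R\<^sub>2 = cls (s2, (u2, v2))"
    using R(2) by (auto simp: nbhd_def points_X)
  have cu: "cis (2 * pi * u1) = cis (2 * pi * u2)" and cv: "cis (2 * pi * v1) = cis (2 * pi * v2)"
    using cov w1 w2 covering_cls by (auto simp: torus_proj_def)
  have "(s1, (u1, v1)) \<in> star ?Q" "(s2, (u2, v2)) \<in> star ?Q"
    using R w1 w2 cls_in_nbhd_iff[OF Q] by blast+
  then obtain a1 b1 a2 b2 where ab1: "(s1, (a1, b1)) \<in> ?Q" "a1 \<in> {0..1}" "b1 \<in> {0..1}"
      "u1 \<in> star_interval a1" "v1 \<in> star_interval b1"
    and ab2: "(s2, (a2, b2)) \<in> ?Q" "a2 \<in> {0..1}" "b2 \<in> {0..1}"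
      "u2 \<in> star_interval a2" "v2 \<in> star_interval b2"
    by (metis starE[OF Q])
  have s12: "s1 \<in> carrier G" "s2 \<in> carrier G" using w1 w2 by auto
  have "frac01 a \<noteq> 0 \<or> frac01 b \<noteq> 0" using q(2) by (auto simp: punctured_square_def frac01_def)
  moreover have l: "point_label (s1, (a1, b1)) = point_label (s, (a, b))" "point_label (s2, (a2, b2)) = point_label (s, (a, b))"
    using ab1(1) ab2(1) cls_eq[OF q(1)] by blast+
  ultimately have base: "base (s1, (a1, b1)) = base (s2, (a2, b2))"
    and fa: "frac01 a1 = frac01 a2" and fb: "frac01 b1 = frac01 b2"
    and nc: "frac01 a1 \<noteq> 0 \<or> frac01 b1 \<noteq> 0"
    using base_closed[of "(s1, (a1, b1))"] base_closed[of "(s2, (a2, b2))"] s12 ab1 ab2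
    by (auto simp: point_label_def l_coset_def)
  have same: ?thesis if "s1 = s2" "a1 = a2" "b1 = b2"
  proof -
    have "u1 = u2" "v1 = v2" using star_interval_inj cu cv ab1 ab2 that by blast+
    then show ?thesis using w1 w2 that by simp
  qed
  consider "a1 = a2" "b1 = b2" | "a1 = 1" "a2 = 0" "b1 = b2" "b1 \<noteq> 1" | "a1 = 0" "a2 = 1" "b1 = b2" "b1 \<noteq> 1"
    | "b1 = 1" "b2 = 0" "a1 = a2" "a1 \<noteq> 1" | "b1 = 0" "b2 = 1" "a1 = a2" "a1 \<noteq> 1"
    using fa fb nc by (auto simp: frac01_def split: if_splits)
  then show ?thesis
  proof cases
    case 1
    then have "s1 = s2" using base s12 by (auto simp: base_def split: if_splits)
    then show ?thesis using 1 same by blast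
  next
    case 2
    then have "s2 = s1 \<otimes> x" "u1 = 1" "u2 = 0" "v1 = v2"
      using base s12 star_interval_opposite[OF _ _ cu] star_interval_inj[OF _ _ cv] ab1 ab2
      by (auto simp: base_def)
    then show ?thesis using glue_right[of s1 v1] w1 w2 by auto
  next
    case 3
    then have "s1 = s2 \<otimes> x" "u2 = 1" "u1 = 0" "v1 = v2"
      using base s12 star_interval_opposite[OF _ _ cu[symmetric]] star_interval_inj[OF _ _ cv] ab1 ab2
      by (auto simp: base_def)
    then show ?thesis using glue_right[of s2 v1] w1 w2 by auto
  next
    case 4
    then have "s2 = s1 \<otimes> y" "v1 = 1" "v2 = 0" "u1 = u2"
      using base s12 star_interval_opposite[OF _ _ cv] star_interval_inj[OF _ _ cu] ab1 ab2
      by (auto simp: base_def)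
    then show ?thesis using glue_up[of s1 u1] w1 w2 by auto
  next
    case 5
    then have "s1 = s2 \<otimes> y" "v2 = 1" "v1 = 0" "u1 = u2"
      using base s12 star_interval_opposite[OF _ _ cv[symmetric]] star_interval_inj[OF _ _ cu] ab1 ab2
      by (auto simp: base_def)
    then show ?thesis using glue_up[of s2 u1] w1 w2 by auto
  qed
qed

lemma covering_punctured_square:
  assumes "z \<in> punctured_square" "(t, z') \<in> sqs" "torus_proj z' = torus_proj z"
  shows "z' \<in> punctured_square"
proof -
  obtain u v u' v' where e: "z = (u, v)" "z' = (u', v')" by (metis prod.collapse)
  have z: "u \<in> {0..1}" "v \<in> {0..1}" "u' \<in> {0..1}" "v' \<in> {0..1}"
    using assms e punctured_square_subset by auto
  have "cis (2 * pi * u') = cis (2 * pi * u)" "cis (2 * pi * v') = cis (2 * pi * v)"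
    using assms(3) e by (auto simp: torus_proj_def)
  then have "u' = u \<or> {u', u} = {0, 1}" "v' = v \<or> {v', v} = {0, 1}"
    using cis_2pi_eq_imp z by blast+
  then show ?thesis using assms(1) z unfolding e punctured_square_def by (auto simp: doubleton_eq_iff)
qed

section \<open>Rigidity of maps over the torus\<close>

definition map_over_torus :: "(('a \<times> (real \<times> real)) set \<Rightarrow> ('a \<times> (real \<times> real)) set) \<Rightarrow> bool" where
  "map_over_torus f \<longleftrightarrow> continuous_map (surface X) (surface X) f \<and>
     (\<forall>P\<in>points X. covering X (f P) = covering X P)"

lemma map_over_torus_point: "map_over_torus f \<Longrightarrow> P \<in> points X \<Longrightarrow> f P \<in> points X"
  using continuous_map_image_subset_topspace[of "surface X" "surface X" f]
  by (auto simp: map_over_torus_def topspace_surface)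

lemma map_over_torus_preimage:
  "map_over_torus f \<Longrightarrow> openin (surface X) U \<Longrightarrow> openin (surface X) {P \<in> points X. f P \<in> U}"
  using openin_continuous_map_preimage[of "surface X" "surface X" f U]
  by (simp add: map_over_torus_def topspace_surface)

lemma disagreement_open:
  assumes f: "map_over_torus f" and g: "map_over_torus g"
  shows "openin (surface X) {P \<in> points X. f P \<noteq> g P}"
proof (subst openin_subopen, intro ballI)
  fix P assume "P \<in> {P \<in> points X. f P \<noteq> g P}"
  then have P: "P \<in> points X" "f P \<noteq> g P" by auto
  let ?U = "{R \<in> points X. f R \<in> nbhd (f P)} \<inter> {R \<in> points X. g R \<in> nbhd (g P)}"
  have fg: "f P \<in> points X" "g P \<in> points X" using P f g map_over_torus_point by blast+
  have "openin (surface X) ?U"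
    using fg f g by (intro openin_Int map_over_torus_preimage openin_nbhd)
  moreover have "P \<in> ?U" using P fg self_in_nbhd by blast
  moreover have "?U \<subseteq> {P \<in> points X. f P \<noteq> g P}"
  proof
    fix R assume R: "R \<in> ?U"
    have "covering X (f P) = covering X (g P)" using P f g by (simp add: map_over_torus_def)
    then have "f R \<noteq> g R" using stars_disjoint[OF fg, of "f R"] P(2) R by auto
    then show "R \<in> {P \<in> points X. f P \<noteq> g P}" using R by blast
  qed
  ultimately show "\<exists>T. openin (surface X) T \<and> P \<in> T \<and> T \<subseteq> {P \<in> points X. f P \<noteq> g P}" by blast
qed

lemma openin_punctured_square:
  assumes "openin (surface X) U" "s \<in> carrier G"
  shows "openin (top_of_set punctured_square) {z \<in> punctured_square. cls (s, z) \<in> U}"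
proof -
  obtain T where T: "open T" "{z \<in> unit_square. cls (s, z) \<in> U} = unit_square \<inter> T"
    using openin_surfaceD[OF assms] by (auto simp: openin_open)
  then have "{z \<in> punctured_square. cls (s, z) \<in> U} = punctured_square \<inter> T" using punctured_square_subset by blast
  then show ?thesis using T(1) by auto
qed

text \<open>The set of agreement is closed by \<open>disagreement_open\<close> and open by \<open>star_injective\<close>.\<close>

lemma agree_on_punctured_square:
  assumes f: "map_over_torus f" and g: "map_over_torus g" and s: "s \<in> carrier G"
    and z0: "z0 \<in> punctured_square" "f (cls (s, z0)) = g (cls (s, z0))" and z: "z \<in> punctured_square"
  shows "f (cls (s, z)) = g (cls (s, z))"
proof -
  let ?E = "{z \<in> punctured_square. f (cls (s, z)) = g (cls (s, z))}"
  have pt: "cls (s, z) \<in> points X" if "z \<in> punctured_square" for z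
    using that s punctured_square_subset by (auto simp: points_X)
  have "openin (top_of_set punctured_square) {z \<in> punctured_square. cls (s, z) \<in> {P \<in> points X. f P \<noteq> g P}}"
    using openin_punctured_square[OF disagreement_open[OF f g] s] .
  also have "{z \<in> punctured_square. cls (s, z) \<in> {P \<in> points X. f P \<noteq> g P}} = punctured_square - ?E" using pt by auto
  finally have closed: "closedin (top_of_set punctured_square) ?E" by (auto simp: closedin_def)
  have "openin (top_of_set punctured_square) ?E"
  proof (subst openin_subopen, intro ballI)
    fix z assume "z \<in> ?E"
    then have z: "z \<in> punctured_square" "f (cls (s, z)) = g (cls (s, z))" by auto
    let ?Q = "f (cls (s, z))"
    have Q: "?Q \<in> points X" using f pt z map_over_torus_point by blast
    then obtain t a b where ab: "(t, (a, b)) \<in> sqs" "?Q = cls (t, (a, b))" by (auto simp: points_X)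
    have "torus_proj (a, b) = torus_proj z"
    proof -
      have "(s, z) \<in> sqs" using s z(1) punctured_square_subset by blast
      moreover have "covering X ?Q = covering X (cls (s, z))"
        using f pt[OF z(1)] by (simp add: map_over_torus_def)
      ultimately show ?thesis
        using covering_cls[OF ab(1)] covering_cls[of "(s, z)"] ab(2) by simp
    qed
    then have abD: "(a, b) \<in> punctured_square" using covering_punctured_square z(1) ab(1) by blast
    let ?U = "{R \<in> points X. f R \<in> nbhd ?Q} \<inter> {R \<in> points X. g R \<in> nbhd ?Q}"
    have "openin (surface X) ?U"
      using Q f g by (intro openin_Int map_over_torus_preimage openin_nbhd)
    then have "openin (top_of_set punctured_square) {z \<in> punctured_square. cls (s, z) \<in> ?U}" using openin_punctured_square s by blast
    moreover have "z \<in> {z \<in> punctured_square. cls (s, z) \<in> ?U}"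
      using z pt Q self_in_nbhd[OF Q] by auto
    moreover have "{z \<in> punctured_square. cls (s, z) \<in> ?U} \<subseteq> ?E"
    proof clarsimp
      fix u v assume "f (cls (s, u, v)) \<in> nbhd ?Q" "g (cls (s, u, v)) \<in> nbhd ?Q" "cls (s, u, v) \<in> points X"
      then show "f (cls (s, u, v)) = g (cls (s, u, v))"
        using star_injective[OF ab(1) abD] f g ab(2) by (simp add: map_over_torus_def)
    qed
    ultimately show "\<exists>T. openin (top_of_set punctured_square) T \<and> z \<in> T \<and> T \<subseteq> ?E" by blast
  qed
  then have "?E = {} \<or> ?E = punctured_square" using connected_punctured_square closed by (auto simp: connected_clopen)
  then show ?thesis using z0 z by blast
qed

lemma interior_dense:
  assumes "openin (top_of_set unit_square) U" "U \<noteq> {}"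
  shows "U \<inter> punctured_square \<noteq> {}"
proof -
  obtain T where T: "open T" "U = unit_square \<inter> T" using assms(1) by (auto simp: openin_open)
  let ?I = "{0<..<1} \<times> {0<..<1::real}"
  have "unit_square = closure ?I" by (simp add: closure_Times)
  then have "T \<inter> closure ?I \<noteq> {}" using T assms(2) by blast
  then have "T \<inter> ?I \<noteq> {}" using open_Int_closure_eq_empty[OF T(1), of ?I] by blast
  moreover have "?I \<subseteq> punctured_square" by (auto simp: punctured_square_def)
  ultimately show ?thesis using T(2) punctured_square_subset by blast
qed

text \<open>Agreement passes from a square to its neighbours through the midpoint of the common edge. The
  corners remain, but a nonempty open set of disagreement would contain other points.\<close>

lemma map_over_torus_unique:
  assumes f: "map_over_torus f" and g: "map_over_torus g" and s: "s \<in> carrier G"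
    and z0: "z0 \<in> punctured_square" "f (cls (s, z0)) = g (cls (s, z0))" and P: "P \<in> points X"
  shows "f P = g P"
proof -
  define T where "T = {s. \<forall>z\<in>punctured_square. f (cls (s, z)) = g (cls (s, z))}"
  have T: "t \<in> T \<longleftrightarrow> f (cls (t, z)) = g (cls (t, z))" if "t \<in> carrier G" "z \<in> punctured_square" for t z
    using that agree_on_punctured_square[OF f g that(1)] unfolding T_def by blast
  have 1: "t \<otimes> x \<in> T \<longleftrightarrow> t \<in> T" if "t \<in> carrier G" for t
    using T[of t "(1, 1/2)"] T[of "t \<otimes> x" "(0, 1/2)"] glue_right[of t "1/2"] that
    by (simp add: punctured_square_def)
  have 2: "t \<otimes> y \<in> T \<longleftrightarrow> t \<in> T" if "t \<in> carrier G" for t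
    using T[of t "(1/2, 1)"] T[of "t \<otimes> y" "(1/2, 0)"] glue_up[of t "1/2"] that
    by (simp add: punctured_square_def)
  have all: "t \<in> T" if "t \<in> carrier G" for t
    using generated_induct[of s T t] 1 2 s T[OF s z0(1)] z0(2) that by blast
  show ?thesis
  proof (rule ccontr)
    assume ne: "f P \<noteq> g P"
    obtain t z where t: "t \<in> carrier G" "z \<in> unit_square" "P = cls (t, z)"
      using P unfolding points_X by blast
    let ?U = "{z \<in> unit_square. cls (t, z) \<in> {P \<in> points X. f P \<noteq> g P}}"
    have "openin (top_of_set unit_square) ?U"
      using openin_surfaceD[OF disagreement_open[OF f g] t(1)] .
    moreover have "z \<in> ?U" using t ne P by blast
    ultimately obtain z' where "z' \<in> ?U" "z' \<in> punctured_square" using interior_dense[of ?U] by blast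
    then show False using all[OF t(1)] T t(1) by blast
  qed
qed

section \<open>The deck group\<close>

definition translate :: "'a \<Rightarrow> 'a \<times> (real \<times> real) \<Rightarrow> 'a \<times> (real \<times> real)" where
  "translate h w = (h \<otimes> fst w, snd w)"

definition act :: "'a \<Rightarrow> ('a \<times> (real \<times> real)) set \<Rightarrow> ('a \<times> (real \<times> real)) set" where
  "act h = (\<lambda>P\<in>points X. translate h ` P)"

lemma translate_closed: "h \<in> carrier G \<Longrightarrow> w \<in> sqs \<Longrightarrow> translate h w \<in> sqs"
  by (cases w) (simp add: translate_def)

lemma inv_mult_cancel: "h \<in> carrier G \<Longrightarrow> s \<in> carrier G \<Longrightarrow> inv h \<otimes> (h \<otimes> s) = s"
  using m_assoc[of "inv h" h s] by simp

lemma translate_inv: "h \<in> carrier G \<Longrightarrow> w \<in> sqs \<Longrightarrow> translate (inv h) (translate h w) = w"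
  by (cases w) (simp add: translate_def inv_mult_cancel)

lemma translate_cls:
  assumes h: "h \<in> carrier G" and e: "w' \<in> cls w"
  shows "translate h w' \<in> cls (translate h w)"
proof -
  have step: "(translate h a, translate h b) \<in> glue X" if "(a, b) \<in> glue X" for a b
    using that h by (auto simp: glue_def translate_def m_assoc)
  have "(translate h w, translate h w') \<in> (glue X \<union> (glue X)\<inverse>)\<^sup>*"
  proof -
    have "(w, w') \<in> (glue X \<union> (glue X)\<inverse>)\<^sup>*"
      using e by (simp add: glue_class_def glue_equiv_def)
    then show ?thesis
      by (induction rule: rtrancl_induct) (auto intro: rtrancl_into_rtrancl dest: step)
  qed
  then show ?thesis by (simp add: glue_class_def glue_equiv_def)
qed

lemma act_cls:
  assumes h: "h \<in> carrier G" and w: "w \<in> sqs"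
  shows "act h (cls w) = cls (translate h w)"
proof -
  have "w' \<in> translate h ` cls w" if w': "w' \<in> cls (translate h w)" for w'
  proof
    have "w' \<in> sqs" using w' by (simp add: cls_eq[OF translate_closed[OF h w]])
    then show "w' = translate h (translate (inv h) w')"
      using translate_inv[of "inv h"] h by simp
    show "translate (inv h) w' \<in> cls w"
      using translate_cls[OF _ w', of "inv h"] translate_inv[OF h w] h by simp
  qed
  then have "translate h ` cls w = cls (translate h w)" using translate_cls[OF h, of _ w] by (intro equalityI subsetI) auto
  moreover have "cls w \<in> points X" using w by (auto simp: points_X)
  ultimately show ?thesis by (simp add: act_def)
qed

lemma act_pair: "h \<in> carrier G \<Longrightarrow> s \<in> carrier G \<Longrightarrow> z \<in> unit_square \<Longrightarrow>
    act h (cls (s, z)) = cls (h \<otimes> s, z)"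
  using act_cls[of h "(s, z)"] by (simp add: translate_def)

lemma pointE:
  assumes "P \<in> points X"
  obtains s z where "s \<in> carrier G" "z \<in> unit_square" "P = cls (s, z)"
  using assms unfolding points_X by blast

lemma act_point: "h \<in> carrier G \<Longrightarrow> P \<in> points X \<Longrightarrow> act h P \<in> points X"
  by (erule pointE) (auto simp: act_pair points_X)

lemma act_act: "h \<in> carrier G \<Longrightarrow> k \<in> carrier G \<Longrightarrow> P \<in> points X \<Longrightarrow> act h (act k P) = act (h \<otimes> k) P"
  by (erule pointE) (simp add: act_pair m_assoc)

lemma act_inv: "h \<in> carrier G \<Longrightarrow> P \<in> points X \<Longrightarrow> act (inv h) (act h P) = P"
  by (erule pointE) (simp add: act_pair inv_mult_cancel)

lemma map_over_torus_act: "h \<in> carrier G \<Longrightarrow> map_over_torus (act h)"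
  unfolding map_over_torus_def continuous_map_def topspace_surface
proof (intro conjI allI impI ballI)
  assume h: "h \<in> carrier G"
  show "act h \<in> points X \<rightarrow> points X" using act_point h by blast
  fix U assume U: "openin (surface X) U"
  show "openin (surface X) {P \<in> points X. act h P \<in> U}"
  proof (rule openin_surfaceI)
    fix s assume s: "s \<in> carrier G"
    have "{z \<in> unit_square. cls (s, z) \<in> {P \<in> points X. act h P \<in> U}}
        = {z \<in> unit_square. cls (h \<otimes> s, z) \<in> U}"
      using s h act_pair unfolding points_X by auto
    then show "openin (top_of_set unit_square)
        {z \<in> unit_square. cls (s, z) \<in> {P \<in> points X. act h P \<in> U}}"
      using openin_surfaceD[OF U, of "h \<otimes> s"] h s by simp
  qed auto
next
  fix P assume "h \<in> carrier G" "P \<in> points X"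
  then show "covering X (act h P) = covering X P"
    by (elim pointE) (simp add: act_pair covering_cls)
qed

lemma act_deck: assumes h: "h \<in> carrier G" shows "act h \<in> carrier (deck_group X)"
proof -
  have "homeomorphic_maps (surface X) (surface X) (act h) (act (inv h))"
    using h map_over_torus_act[of h] map_over_torus_act[of "inv h"] act_inv[of h] act_inv[of "inv h"]
    by (simp add: homeomorphic_maps_def map_over_torus_def topspace_surface)
  then have "homeomorphic_map (surface X) (surface X) (act h)" by (rule homeomorphic_maps_imp_map)
  moreover from this have "act h \<in> Bij (points X)"
    by (auto simp: Bij_def act_def homeomorphic_eq_everything_map topspace_surface bij_betw_def)
  ultimately show ?thesis using map_over_torus_act[OF h] by (simp add: deck_group_def map_over_torus_def)
qed

lemma map_over_torus_deck: "f \<in> carrier (deck_group X) \<Longrightarrow> map_over_torus f"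
  by (simp add: deck_group_def map_over_torus_def homeomorphic_imp_continuous_map)

text \<open>The centre of the square \<open>\<one>\<close> goes to the centre of some square \<open>h\<close>, where \<open>act h\<close> sends it too;
  rigidity does the rest.\<close>

lemma deck_is_act:
  assumes f: "f \<in> carrier (deck_group X)"
  shows "\<exists>h\<in>carrier G. f = act h"
proof -
  let ?z = "(1/2, 1/2) :: real \<times> real"
  let ?P = "cls (\<one>, ?z)"
  have P: "?P \<in> points X" by (auto simp: points_X)
  have "f ?P \<in> points X" using map_over_torus_point[OF map_over_torus_deck[OF f] P] .
  then obtain h u v where h: "(h, (u, v)) \<in> sqs" "f ?P = cls (h, (u, v))" by (auto simp: points_X)
  have "covering X (f ?P) = covering X ?P" using map_over_torus_deck[OF f] P by (simp add: map_over_torus_def)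
  then have "torus_proj (u, v) = torus_proj ?z"
    using covering_cls[OF h(1)] covering_cls[of "(\<one>, ?z)"] h(2) by simp
  then have "cis (2 * pi * u) = cis (2 * pi * (1/2))" "cis (2 * pi * v) = cis (2 * pi * (1/2))"
    by (simp_all add: torus_proj_def)
  then have "u = 1/2" "v = 1/2"
    using cis_2pi_eq_imp[of u "1/2"] cis_2pi_eq_imp[of v "1/2"] h(1) by (auto simp: doubleton_eq_iff)
  then have "f (cls (\<one>, ?z)) = cls (h, ?z)" using h(2) by (simp only:)
  then have eq: "f (cls (\<one>, ?z)) = act h (cls (\<one>, ?z))" using h(1) by (simp add: act_pair)
  have hG: "h \<in> carrier G" using h(1) by blast
  have "f P = act h P" if "P \<in> points X" for P
    using map_over_torus_unique[OF map_over_torus_deck[OF f] map_over_torus_act[OF hG] one_closed _ eq that]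
    by (simp add: punctured_square_def)
  moreover have "f \<in> extensional (points X)" "act h \<in> extensional (points X)"
    using f by (auto simp: deck_group_def Bij_def act_def)
  ultimately have "f = act h" by (intro extensionalityI[of f "points X"])
  then show ?thesis using hG by blast
qed

lemma act_iso: "act \<in> iso G (deck_group X)"
proof -
  have "act h = act k \<Longrightarrow> h = k" if "h \<in> carrier G" "k \<in> carrier G" for h k
  proof -
    assume "act h = act k"
    then have "act h (cls (\<one>, (1/2, 1/2))) = act k (cls (\<one>, (1/2, 1/2)))" by simp
    then have "point_label (h, (1/2, 1/2)) = point_label (k, (1/2, 1/2))"
      using that by (simp add: act_pair cls_eq_iff)
    then show "h = k" using that by (simp add: point_label_def frac01_def base_def l_coset_def)
  qed
  then have "inj_on act (carrier G)" by (auto simp: inj_on_def)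
  moreover have "act ` carrier G = carrier (deck_group X)" using act_deck deck_is_act by blast
  moreover have "act (h \<otimes> k) = act h \<otimes>\<^bsub>deck_group X\<^esub> act k" if "h \<in> carrier G" "k \<in> carrier G" for h k
  proof -
    have "act h \<in> Bij (points X)" "act k \<in> Bij (points X)"
      using act_deck that by (auto simp: deck_group_def)
    then have "act h \<otimes>\<^bsub>deck_group X\<^esub> act k = compose (points X) (act h) (act k)"
      by (simp add: deck_group_def BijGroup_def)
    also have "\<dots> = act (h \<otimes> k)"
    proof (rule extensionalityI)
      show "act (h \<otimes> k) \<in> extensional (points X)" by (simp add: act_def)
    qed (use that act_act in \<open>auto simp: compose_def\<close>)
    finally show ?thesis by simp
  qed
  ultimately show ?thesis by (auto simp: iso_def hom_def bij_betw_def)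
qed

lemma closed_square_eq: "s \<in> carrier G \<Longrightarrow> closed_square X s = (\<lambda>z. cls (s, z)) ` unit_square"
proof (intro equalityI subsetI)
  fix P assume s: "s \<in> carrier G" and "P \<in> closed_square X s"
  then obtain z where "P \<in> points X" "(s, z) \<in> P" by (auto simp: closed_square_def)
  then show "P \<in> (\<lambda>z. cls (s, z)) ` unit_square" using point_eq_cls by blast
next
  fix P assume s: "s \<in> carrier G" and "P \<in> (\<lambda>z. cls (s, z)) ` unit_square"
  then show "P \<in> closed_square X s"
    using glue_class_self[of "(s, z)" X for z] unfolding closed_square_def points_X by fast
qed

lemma normal_X: "normal_origami X"
  unfolding normal_origami_def
proof (intro conjI ballI)
  fix s t assume "s \<in> squares X" "t \<in> squares X"
  then have s: "s \<in> carrier G" "t \<in> carrier G" by auto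
  let ?h = "t \<otimes> inv s"
  have h: "?h \<in> carrier G" "?h \<otimes> s = t" using s by (simp_all add: m_assoc)
  have "act ?h ` closed_square X s = closed_square X t"
    using s h by (simp add: closed_square_eq image_image act_pair cong: image_cong_simp)
  then show "\<exists>f\<in>carrier (deck_group X). f ` closed_square X s = closed_square X t"
    using act_deck[OF h(1)] by blast
qed (rule is_origami_X)

lemma p_origami_X:
  assumes "order G = p ^ n"
  shows "p_origami p X"
proof -
  have "bij_betw act (carrier G) (carrier (deck_group X))" using act_iso by (simp add: iso_def)
  then have "finite (carrier (deck_group X))" "order (deck_group X) = p ^ n"
    using fin assms by (auto simp: bij_betw_finite order_def dest: bij_betw_same_card)
  then show ?thesis using normal_X by (auto simp: p_origami_def)
qed

section \<open>Multiplicities and strata\<close>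

text \<open>Each representative of the corner contributes the angle \<open>\<pi>/2\<close>, and there are \<open>ord turn\<close>
  representatives at each of the four corners of the unit square.\<close>

lemma cone_angle_corner:
  assumes g: "g \<in> carrier G"
  shows "cone_angle (cls (g, (0, 0))) = 2 * pi * ord turn"
proof -
  let ?K = "{0, 1} \<times> {0, 1} :: (real \<times> real) set"
  define m where "m = (\<lambda>z :: real \<times> real. (if fst z = 1 then x else \<one>) \<otimes> (if snd z = 1 then y else \<one>))"
  have m: "m z \<in> carrier G" for z by (simp add: m_def)
  have base_m: "base (t, z) = t \<otimes> m z" if "t \<in> carrier G" for t z
    using that by (cases z) (simp add: base_def m_def m_assoc)
  let ?F = "\<lambda>(d, z). (g \<otimes> d \<otimes> inv (m z), z)"
  have P: "cls (g, (0, 0)) = ?F ` (turns \<times> ?K)"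
  proof (intro equalityI subsetI)
    fix w assume "w \<in> cls (g, (0, 0))"
    then have w: "w \<in> sqs" "point_label w = point_label (g, (0, 0))" using cls_eq[of "(g, (0, 0))"] g by auto
    obtain t z where e: "w = (t, z)" by (metis prod.collapse)
    have z: "z \<in> ?K" using w e by (cases z) (auto simp: point_label_def frac01_def split: if_splits)
    have t: "t \<in> carrier G" using w e by blast
    have "base w <# turns = g <# turns"
    proof -
      have "fst (point_label w) = base w <# turns"
        using z unfolding e by (cases z) (auto simp: point_label_def frac01_def)
      moreover have "fst (point_label (g, (0, 0))) = g <# turns"
        using g by (simp add: point_label_def frac01_def base_def)
      ultimately show ?thesis using w(2) by simp
    qed
    then have "t \<otimes> m z \<in> g <# turns"
      using lcos_self[OF _ turns_subgroup, of "t \<otimes> m z"] base_m[OF t] t m e by simp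
    then obtain d where d: "d \<in> turns" "t \<otimes> m z = g \<otimes> d" by (auto simp: l_coset_def)
    have "t = t \<otimes> m z \<otimes> inv (m z)" using t m by (simp add: m_assoc)
    then have "t = g \<otimes> d \<otimes> inv (m z)" using d by simp
    then show "w \<in> ?F ` (turns \<times> ?K)" using d z e by auto
  next
    fix w assume "w \<in> ?F ` (turns \<times> ?K)"
    then obtain dz where dz: "dz \<in> turns \<times> ?K" "w = ?F dz" by (rule imageE)
    obtain d z where "dz = (d, z)" by (metis prod.collapse)
    with dz have d: "d \<in> turns" "z \<in> ?K" and w: "w = (g \<otimes> d \<otimes> inv (m z), z)" by simp_all
    have dG: "d \<in> carrier G" using d turns_subset by blast
    have "base w = g \<otimes> d" using base_m[of "g \<otimes> d \<otimes> inv (m z)" z] g dG m w by (simp add: m_assoc)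
    moreover have "(g \<otimes> d) <# turns = g <# turns"
      using lcos_m_assoc[OF turns_subset g dG] coset_join3[OF dG turns_subgroup d(1)] by simp
    moreover have "point_label w = (base w <# turns, 0, 0)"
      using d(2) unfolding w by (cases z) (auto simp: point_label_def frac01_def)
    moreover have "point_label (g, (0, 0)) = (g <# turns, 0, 0)"
      using g by (simp add: point_label_def frac01_def base_def)
    ultimately have "point_label w = point_label (g, (0, 0))" by simp
    moreover have "w \<in> sqs" using w d(2) g dG m by auto
    ultimately show "w \<in> cls (g, (0, 0))" using cls_eq[of "(g, (0, 0))"] g by auto
  qed
  have inj: "inj_on ?F (turns \<times> ?K)"
    using g m turns_subset by (auto simp: inj_on_def subset_iff)
  have "cone_angle (cls (g, (0, 0))) = (\<Sum>w\<in>cls (g, (0, 0)). pi / 2)"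
    unfolding cone_angle_def by (rule sum.cong) (auto simp: P square_angle_def)
  also have "\<dots> = card (turns \<times> ?K) * (pi / 2)"
    unfolding P by (simp only: sum_constant card_image[OF inj])
  also have "card (turns \<times> ?K) = 4 * card turns"
    by (simp add: card_cartesian_product)
  also have "card turns = ord turn" unfolding turns_def using generate_pow_card[OF turn_closed] by simp
  finally show ?thesis by simp
qed

lemma cone_angle_edge:
  assumes g: "g \<in> carrier G" and t: "t \<in> {0<..<1}"
  shows "cone_angle (cls (g, (0, t))) = 2 * pi" "cone_angle (cls (g, (t, 0))) = 2 * pi"
proof -
  have "cls (g, (0, t)) = {(g, (0, t)), (g \<otimes> inv x, (1, t))}"
    using t g
    by (subst cls_eq) (auto simp: point_label_def frac01_def base_def l_coset_def m_assoc split: if_splits)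
  then show "cone_angle (cls (g, (0, t))) = 2 * pi"
    using t by (simp add: cone_angle_def square_angle_def)
  have "cls (g, (t, 0)) = {(g, (t, 0)), (g \<otimes> inv y, (t, 1))}"
    using t g
    by (subst cls_eq) (auto simp: point_label_def frac01_def base_def l_coset_def m_assoc split: if_splits)
  then show "cone_angle (cls (g, (t, 0))) = 2 * pi"
    using t by (simp add: cone_angle_def square_angle_def)
qed

lemma cone_angle_interior:
  assumes g: "g \<in> carrier G" and t: "u \<in> {0<..<1}" "v \<in> {0<..<1}"
  shows "cone_angle (cls (g, (u, v))) = 2 * pi"
proof -
  have "cls (g, (u, v)) = {(g, (u, v))}"
    using t g
    by (subst cls_eq) (auto simp: point_label_def frac01_def base_def l_coset_def split: if_splits)
  then show ?thesis using t by (simp add: cone_angle_def square_angle_def)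
qed

definition corners :: "('a \<times> (real \<times> real)) set set" where
  "corners = (\<lambda>g. cls (g, (0, 0))) ` carrier G"

lemma singular_points:
  assumes a: "a > 0"
  shows "{P \<in> points X. has_multiplicity P (a + 1)} = (if ord turn = a + 1 then corners else {})"
proof -
  have corner: "has_multiplicity P (a + 1) \<longleftrightarrow> ord turn = a + 1" if "P \<in> corners" for P
  proof -
    have "cone_angle P = 2 * pi * ord turn" using that cone_angle_corner by (auto simp: corners_def)
    moreover have "2 * pi * real (ord turn) = 2 * pi * real (a + 1) \<longleftrightarrow> ord turn = a + 1"
      by (metis mult_cancel_left mult_eq_0_iff of_nat_eq_iff pi_neq_zero zero_neq_numeral)
    ultimately show ?thesis unfolding has_multiplicity_def by auto
  qed
  have other: "\<not> has_multiplicity P (a + 1)" if P: "P \<in> points X" "P \<notin> corners" for P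
  proof -
    obtain s u v where w: "(s, (u, v)) \<in> sqs" "P = cls (s, (u, v))" using P by (auto simp: points_X)
    let ?g = "base (s, (u, v))"
    have g: "?g \<in> carrier G" using base_closed w by blast
    have P': "P = cls (?g, (frac01 u, frac01 v))" using cls_base w by blast
    then have "frac01 u \<noteq> 0 \<or> frac01 v \<noteq> 0" using P(2) g by (auto simp: corners_def)
    moreover have "frac01 u \<in> {0..<1}" "frac01 v \<in> {0..<1}" using w by (auto simp: frac01_def)
    ultimately have "cone_angle P = 2 * pi"
      using cone_angle_edge[OF g] cone_angle_interior[OF g]
      unfolding P' by (cases "frac01 u = 0"; cases "frac01 v = 0") auto
    then show ?thesis using a by (simp add: has_multiplicity_def)
  qed
  have "corners \<subseteq> points X" by (auto simp: corners_def points_X)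
  then show ?thesis using corner other by auto
qed

lemma corners_finite: "finite corners" and corners_nonempty: "corners \<noteq> {}"
  using fin by (auto simp: corners_def)

lemma card_singular_points:
  assumes a: "a > 0"
  shows "finite {P \<in> points X. has_multiplicity P (a + 1)}"
    and "card {P \<in> points X. has_multiplicity P (a + 1)} = (if ord turn = a + 1 then card corners else 0)"
  unfolding singular_points[OF a] using corners_finite by auto

text \<open>The filter covers the case of a trivial commutator, where no point is singular.\<close>

lemma stratum_X: "\<exists>H\<in>strata. X \<in> H"
proof -
  define \<mu> where "\<mu> = filter_mset (\<lambda>a. a > 0) (replicate_mset (card corners) (ord turn - 1))"
  have "count \<mu> a = (if ord turn = a + 1 then card corners else 0)" if "a > 0" for a
    using that by (auto simp: \<mu>_def)
  then have "X \<in> stratum \<mu>"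
    unfolding stratum_def mem_Collect_eq
    by (intro conjI allI impI is_origami_X) (simp_all only: card_singular_points)
  moreover have "\<forall>a\<in>#\<mu>. a > 0" by (simp add: \<mu>_def)
  then have "stratum \<mu> \<in> strata" unfolding strata_def by blast
  ultimately show ?thesis by blast
qed

end

lemma same_stratum_same_commutator_order:
  fixes G :: "('a, 'b) monoid_scheme" and G' :: "('a, 'c) monoid_scheme"
  assumes "two_generated_group G x y" "two_generated_group G' x' y'"
    and "H \<in> strata" "group_origami G x y \<in> H" "group_origami G' x' y' \<in> H"
  shows "group.ord G (commutator G x y) = group.ord G' (commutator G' x' y')"
proof -
  interpret A: two_generated_group G x y by fact
  interpret B: two_generated_group G' x' y' by fact
  obtain \<mu> where "H = stratum \<mu>" using assms(3) unfolding strata_def by blast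
  then have "card {P \<in> points A.X. has_multiplicity P (a + 1)}
      = card {P \<in> points B.X. has_multiplicity P (a + 1)}" if "a > 0" for a
    using assms(4,5) that unfolding stratum_def by simp
  then have card_eq: "(if A.ord A.turn = a + 1 then card A.corners else 0)
      = (if B.ord B.turn = a + 1 then card B.corners else 0)" if "a > 0" for a
    using that by (simp only: A.card_singular_points B.card_singular_points)
  have pos: "card A.corners > 0" "card B.corners > 0"
    using A.corners_finite A.corners_nonempty B.corners_finite B.corners_nonempty
    by (simp_all add: card_gt_0_iff)
  have iff: "A.ord A.turn = a + 1 \<longleftrightarrow> B.ord B.turn = a + 1" if "a > 0" for a
    using card_eq[OF that] pos by (auto split: if_splits)
  have "A.ord A.turn \<ge> 1" "B.ord B.turn \<ge> 1"
    using A.ord_ge_1[OF A.fin A.turn_closed] B.ord_ge_1[OF B.fin B.turn_closed] by auto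
  then have "A.ord A.turn = B.ord B.turn"
    using iff[of "A.ord A.turn - 1"] iff[of "B.ord B.turn - 1"]
    by (cases "A.ord A.turn = 1"; cases "B.ord B.turn = 1") auto
  then show ?thesis by (simp add: A.turn_def B.turn_def)
qed

section \<open>Origamis in different strata\<close>

theorem proposition4p16:
  fixes p :: nat
  assumes "prime p"
  shows "\<exists>(X\<^sub>1 :: nat origami) (X\<^sub>2 :: nat origami).
           p_origami p X\<^sub>1 \<and> p_origami p X\<^sub>2 \<and>
           deck_group X\<^sub>1 \<cong> deck_group X\<^sub>2 \<and>
           (\<exists>H\<^sub>1 \<in> strata. \<exists>H\<^sub>2 \<in> strata. X\<^sub>1 \<in> H\<^sub>1 \<and> X\<^sub>2 \<in> H\<^sub>2 \<and> H\<^sub>1 \<noteq> H\<^sub>2)"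
proof -
  obtain G :: "nat monoid" and x x' y n where "group G" and fin: "finite (carrier G)"
    and n: "order G = p ^ n"
    and mem: "x \<in> carrier G" "x' \<in> carrier G" "y \<in> carrier G"
    and gen: "generate G {x, y} = carrier G" "generate G {x', y} = carrier G"
    and ord: "group.ord G (commutator G x y) \<noteq> group.ord G (commutator G x' y)"
    using p_group_with_two_commutator_orders[OF assms] by blast
  interpret A: two_generated_group G x y
    using \<open>group G\<close> fin mem gen by (simp add: two_generated_group_def two_generated_group_axioms_def)
  interpret B: two_generated_group G x' y
    using \<open>group G\<close> fin mem gen by (simp add: two_generated_group_def two_generated_group_axioms_def)
  have "G \<cong> deck_group A.X" "G \<cong> deck_group B.X"
    using A.act_iso B.act_iso by (auto simp: is_iso_def)
  then have "deck_group A.X \<cong> deck_group B.X"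
    using A.iso_sym iso_trans by blast
  moreover obtain H\<^sub>1 H\<^sub>2 where H: "H\<^sub>1 \<in> strata" "A.X \<in> H\<^sub>1" "H\<^sub>2 \<in> strata" "B.X \<in> H\<^sub>2"
    using A.stratum_X B.stratum_X by blast
  moreover have "H\<^sub>1 \<noteq> H\<^sub>2"
    using same_stratum_same_commutator_order[OF A.two_generated_group_axioms
        B.two_generated_group_axioms] H ord by blast
  ultimately show ?thesis using A.p_origami_X[OF n] B.p_origami_X[OF n] by blast
qed

end
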